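(* For integers $s_1,s_2\ge 0$, $r_1,r_2>0$ and $w\ge s_1+s_2+r_1+r_2+2$, we have $$S_w\begin{pmatrix}s_1,\,s_2\\ r_1,\,r_2\end{pmatrix}=\binom{w-2}{s_1+s_2}\zeta(w)+\sum_{\substack{w_1,w_2\ge 2\\ w_1+w_2=w}}A_{w_1,w_2}^{s_1,s_2,r_1,r_2}\,\zeta(w_1)\zeta(w_2)+\sum_{\substack{w_1\ge 1,\,w_2\ge 2\\ w_1+w_2=w}}B_{w_1,w_2}^{s_1,s_2,r_1,r_2}\,\zeta(w_1,w_2),$$ where the integers $A_{w_1,w_2}^{s_1,s_2,r_1,r_2}$ and $B_{w_1,w_2}^{s_1,s_2,r_1,r_2}$ are given by \begin{align*} A_{w_1,w_2}^{s_1,s_2,r_1,r_2}:={}&(-1)^{w_1}C_{w_1,w_2}^{s_1,s_2}-\mathbf{1}_{w_1\le s_1+r_1\text{ or }w_2\le s_2+r_2-1}\binom{w_1-1}{s_1}\binom{w_2-2}{s_2-1}\\ &+\mathbf{1}_{w_1>s_1+r_1}(-1)^{s_1+r_1+w_1}\binom{w_1-1}{s_1}\binom{w_2-2}{s_1+s_2+r_1-w_1}\\ &+\mathbf{1}_{r_2<w_2\le s_2+r_2-1}(-1)^{s_2+r_2+w_2}\binom{w_1-1}{s_1}\binom{w_2-2}{r_2-1},\\ B_{w_1,w_2}^{s_1,s_2,r_1,r_2}:={}&C_{w_1,w_2}^{s_1,s_2}-(-1)^{s_2}\sum_{\substack{t_1,t_2\ge 0,\ t_1+t_2=s_1\\ t_1\ge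 w_1-(s_2+r_1)\text{ or }t_2\ge w_2-r_2}}\binom{w_1-1}{t_1}\binom{w_2-1}{t_2} \end{align*} with $$C_{w_1,w_2}^{s_1,s_2}:=(-1)^{s_2}\sum_{\substack{0\le i\le s_1\\ 1\le j\le s_2\\ i+j=w_1}}\binom{w_1-1}{i}\binom{w_2-1}{s_1-i}-(-1)^{s_1}\binom{w_1-1}{s_1}\binom{w_2-2}{s_1+s_2-w_1}.$$
   Context: $\mathbf{1}_P$ is $1$ if the condition $P$ holds and $0$ otherwise. For $n,k\in\mathbb{Z}$: $\binom{n}{k}=\frac{n(n-1)\cdots(n-k+1)}{k!}$ if $k>0$, $\binom n0=1$, and $\binom nk=0$ if $k<0$. An index is a tuple of positive integers; its depth is its length, its weight $\mathrm{wt}$ is the sum of its entries; a non-empty index is admissible if its last entry is $\ge 2$ (the empty index is admissible). For an admissible index, $\zeta(k_1,\dots,k_d)=\sum_{0<m_1<\cdots<m_d}m_1^{-k_1}\cdots m_d^{-k_d}$. For integers $w,s_1,s_2\ge 0$ and $r_1,r_2>0$ define $$S_w\begin{pmatrix}s_1,\,s_2\\ r_1,\,r_2\end{pmatrix}:=\sum\ \sum\ \prod_{i=1}^2\frac{1}{a_{i,1}^{k_{i,1}}\cdots a_{i,r_i}^{k_{i,r_i}}\,b_{i,1}^{l_{i,1}}\cdots b_{i,s_i}^{l_{i,s_i}}},$$ where the outer sum is over all indices $\boldsymbol{l}_i=(l_{i,1},\ldots,l_{i,s_i})$ of depth $s_i$ and all admissible indices $\boldsymbol{k}_i=(k_{i,1},\ldots,k_{i,r_i})$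 of depth $r_i$ ($i=1,2$) with $\mathrm{wt}(\boldsymbol{k}_1)+\mathrm{wt}(\boldsymbol{k}_2)+\mathrm{wt}(\boldsymbol{l}_1)+\mathrm{wt}(\boldsymbol{l}_2)=w$, and the inner sum is over all positive integers with $0<b_{i,1}\le\cdots\le b_{i,s_i+1}$, $0<a_{i,1}<\cdots<a_{i,r_i}$, $b_{i,s_i+1}=a_{i,r_i}$ for $i=1,2$, and $b_{2,1}<a_{1,1}$. *)

theory Defs
  imports "HOL-Analysis.Analysis"
begin

section \<open>Binomial coefficients with integer entries\<close>

text \<open>The use of \<open>div\<close> loses nothing: \<open>k!\<close> divides every product of \<open>k\<close> consecutive integers.\<close>

definition ibinom :: "int \<Rightarrow> int \<Rightarrow> int"
  where "ibinom n k = (if k < 0 then 0 else (\<Prod>i<nat k. n - int i) div fact (nat k))"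


section \<open>Indices and multiple zeta values\<close>

definition is_index :: "nat list \<Rightarrow> bool"
  where "is_index k \<longleftrightarrow> (\<forall>x\<in>set k. 0 < x)"

definition admissible :: "nat list \<Rightarrow> bool"
  where "admissible k \<longleftrightarrow> is_index k \<and> (k \<noteq> [] \<longrightarrow> 2 \<le> last k)"

text \<open>Only the first \<^term>\<open>length k\<close> entries of \<open>m\<close> are used.\<close>

definition recip_prod :: "nat list \<Rightarrow> nat list \<Rightarrow> real"
  where "recip_prod k m = (\<Prod>j<length k. 1 / real (m ! j) ^ (k ! j))"

definition mzv :: "nat list \<Rightarrow> real"
  where "mzv k =
    (\<Sum>\<^sub>\<infinity>m\<in>{m. length m = length k \<and> (\<forall>x\<in>set m. 0 < x) \<and> sorted_wrt (<) m}. recip_prod k m)"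


section \<open>The sums \<open>S\<close>\<close>

definition S_indices ::
    "nat \<Rightarrow> nat \<Rightarrow> nat \<Rightarrow> nat \<Rightarrow> nat \<Rightarrow> (nat list \<times> nat list \<times> nat list \<times> nat list) set"
  where "S_indices w s1 s2 r1 r2 =
    {(k1, k2, l1, l2).
       length k1 = r1 \<and> length k2 = r2 \<and> length l1 = s1 \<and> length l2 = s2 \<and>
       admissible k1 \<and> admissible k2 \<and> is_index l1 \<and> is_index l2 \<and>
       sum_list k1 + sum_list k2 + sum_list l1 + sum_list l2 = w}"

text \<open>The list \<open>b1\<close> is \<open>b\<^sub>1\<^sub>,\<^sub>1, \<dots>, b\<^sub>1\<^sub>,\<^sub>s\<^sub>+\<^sub>1\<close> with \<open>s = s1\<close>: its last entry is shared with \<open>a1\<close> and does not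
  contribute a factor of its own to the summand. In particular, for \<open>s2 = 0\<close> the condition
  \<open>hd b2 < hd a1\<close> reads \<open>last a2 < hd a1\<close>.\<close>

definition S_domain ::
    "nat \<Rightarrow> nat \<Rightarrow> nat \<Rightarrow> nat \<Rightarrow> (nat list \<times> nat list \<times> nat list \<times> nat list) set"
  where "S_domain s1 s2 r1 r2 =
    {(a1, a2, b1, b2).
       length a1 = r1 \<and> length a2 = r2 \<and> length b1 = s1 + 1 \<and> length b2 = s2 + 1 \<and>
       (\<forall>x\<in>set a1 \<union> set a2 \<union> set b1 \<union> set b2. 0 < x) \<and>
       sorted_wrt (<) a1 \<and> sorted_wrt (<) a2 \<and> sorted_wrt (\<le>) b1 \<and> sorted_wrt (\<le>) b2 \<and>
       last b1 = last a1 \<and> last b2 = last a2 \<and> hd b2 < hd a1}"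

definition S :: "nat \<Rightarrow> nat \<Rightarrow> nat \<Rightarrow> nat \<Rightarrow> nat \<Rightarrow> real"
  where "S w s1 s2 r1 r2 =
    (\<Sum>(k1, k2, l1, l2)\<in>S_indices w s1 s2 r1 r2.
       \<Sum>\<^sub>\<infinity>(a1, a2, b1, b2)\<in>S_domain s1 s2 r1 r2.
         (recip_prod k1 a1 * recip_prod l1 b1) * (recip_prod k2 a2 * recip_prod l2 b2))"

text \<open>The outer sum in the definition of \<^const>\<open>S\<close> is a genuine finite sum.\<close>

lemma finite_S_indices: "finite (S_indices w s1 s2 r1 r2)"
proof -
  define L where "L n = {xs. set xs \<subseteq> {..w} \<and> length xs = n}" for n
  have sub: "set xs \<subseteq> {..w}" if "sum_list xs \<le> w" for xs :: "nat list"
  proof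
    fix x assume "x \<in> set xs"
    then have "x \<le> sum_list xs" by (rule member_le_sum_list) simp
    then show "x \<in> {..w}" using that by simp
  qed
  have "S_indices w s1 s2 r1 r2 \<subseteq> L r1 \<times> L r2 \<times> L s1 \<times> L s2"
  proof
    fix q assume "q \<in> S_indices w s1 s2 r1 r2"
    then obtain k1 k2 l1 l2 where q: "q = (k1, k2, l1, l2)"
      and len: "length k1 = r1" "length k2 = r2" "length l1 = s1" "length l2 = s2"
      and w: "sum_list k1 + sum_list k2 + sum_list l1 + sum_list l2 = w"
      unfolding S_indices_def by auto
    from w have "sum_list k1 \<le> w" "sum_list k2 \<le> w" "sum_list l1 \<le> w" "sum_list l2 \<le> w"
      by linarith+
    then show "q \<in> L r1 \<times> L r2 \<times> L s1 \<times> L s2"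
      unfolding q L_def using len sub by simp
  qed
  moreover have "finite (L n)" for n
    unfolding L_def by (rule finite_lists_length_eq) simp
  ultimately show ?thesis
    by (meson finite_SigmaI finite_subset)
qed


section \<open>The coefficients\<close>

definition coeff_C :: "nat \<Rightarrow> nat \<Rightarrow> nat \<Rightarrow> nat \<Rightarrow> int"
  where "coeff_C w1 w2 s1 s2 =
    (-1) ^ s2 *
      (\<Sum>(i, j)\<in>{(i, j). 0 \<le> i \<and> i \<le> s1 \<and> 1 \<le> j \<and> j \<le> s2 \<and> i + j = w1}.
         ibinom (int w1 - 1) (int i) * ibinom (int w2 - 1) (int s1 - int i))
    - (-1) ^ s1 * ibinom (int w1 - 1) (int s1) * ibinom (int w2 - 2) (int s1 + int s2 - int w1)"

definition coeff_A :: "nat \<Rightarrow> nat \<Rightarrow> nat \<Rightarrow> nat \<Rightarrow> nat \<Rightarrow> nat \<Rightarrow> int"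
  where "coeff_A w1 w2 s1 s2 r1 r2 =
    (-1) ^ w1 * coeff_C w1 w2 s1 s2
    - of_bool (w1 \<le> s1 + r1 \<or> int w2 \<le> int s2 + int r2 - 1) *
        ibinom (int w1 - 1) (int s1) * ibinom (int w2 - 2) (int s2 - 1)
    + of_bool (w1 > s1 + r1) * (-1) ^ (s1 + r1 + w1) *
        ibinom (int w1 - 1) (int s1) *
        ibinom (int w2 - 2) (int s1 + int s2 + int r1 - int w1)
    + of_bool (r2 < w2 \<and> int w2 \<le> int s2 + int r2 - 1) * (-1) ^ (s2 + r2 + w2) *
        ibinom (int w1 - 1) (int s1) * ibinom (int w2 - 2) (int r2 - 1)"

definition coeff_B :: "nat \<Rightarrow> nat \<Rightarrow> nat \<Rightarrow> nat \<Rightarrow> nat \<Rightarrow> nat \<Rightarrow> int"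
  where "coeff_B w1 w2 s1 s2 r1 r2 =
    coeff_C w1 w2 s1 s2
    - (-1) ^ s2 *
      (\<Sum>(t1, t2)\<in>{(t1, t2). t1 + t2 = s1 \<and>
            (int t1 \<ge> int w1 - (int s2 + int r1) \<or> int t2 \<ge> int w2 - int r2)}.
         ibinom (int w1 - 1) (int t1) * ibinom (int w2 - 1) (int t2))"

end

theory Submission
  imports Defs
begin

text \<open>
  A block is one of the two factors of the summand, that is a strict chain \<open>a\<close> and a weak chain \<open>b\<close>
  with the same last entry. Moving the first entry of \<open>b\<^sub>2\<close> to the front of \<open>a\<^sub>1\<close> turns the condition
  \<open>b\<^sub>2\<^sub>,\<^sub>1 < a\<^sub>1\<^sub>,\<^sub>1\<close> into the negation of the same condition for shorter \<open>b\<^sub>2\<close>. Hence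
  \<open>S\<^sub>w(s\<^sub>1, s\<^sub>2 + 1; r\<^sub>1, r\<^sub>2) + S\<^sub>w(s\<^sub>1, s\<^sub>2; r\<^sub>1 + 1, r\<^sub>2)\<close> is a sum over pairs of unrelated blocks. The generating
  function of the blocks with given depths and weight can be summed by a connected sum, which gives
  a binomial coefficient times a zeta value; the same transformation, applied twice, settles
  \<open>s\<^sub>2 = 0\<close>. The right-hand side of the theorem obeys the same recursion in \<open>s\<^sub>2\<close>: the terms that
  depend on \<open>r\<^sub>1\<close> and \<open>r\<^sub>2\<close> account for the pairs of blocks, and what remains is a regularized
  double shuffle relation, namely the partial fraction expansion of
  \<open>1 / ((m - T)\<^sup>p\<^sup>+\<^sup>1 (n - T)\<^sup>q\<^sup>+\<^sup>1)\<close> summed over \<open>m\<close> and \<open>n\<close>.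
\<close>

section \<open>Sums of nonnegative families and comparison of coefficients\<close>

text \<open>For fixed depths and weight the blocks have no product structure. Once depths and excess
  weight are marked by real parameters, every integer contributes a linear fraction independently of
  the others, and quotients of shifted factorials appear; this is why generating functions enter.
  The parameters are kept small and positive: all families are then nonnegative and summations may
  be interchanged freely, at the price that identities are known on one side of 0 only and
  coefficients must be compared there. The recursion lowers s2 and raises r1 by one, so s2 + r1 and
  the bound on w do not change and only s2 = 0 needs a direct evaluation. There the formula contains
  a multiple of \<zeta>(w) that the direct evaluation lacks; the depth two sum formula spreads it
  over the double zeta values. The obstacle in the double shuffle relation is exponent 1: such terms
  diverge one by one. They all carry the same coefficient up to sign, and their combination
  converges because 1/(n - m) - 1/n does when summed over n. The variable T is formal, so one
  identity of power series serves all weights.\<close>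

lemma has_sum_Sigma_nonneg:
  fixes f :: "'a \<times> 'b \<Rightarrow> real"
  assumes "\<And>x. x \<in> A \<Longrightarrow> ((\<lambda>y. f (x, y)) has_sum g x) (B x)"
    and "(g has_sum T) A"
    and "\<And>x y. x \<in> A \<Longrightarrow> y \<in> B x \<Longrightarrow> 0 \<le> f (x, y)"
  shows "(f has_sum T) (Sigma A B)"
  using assms by (intro has_sum_SigmaI[where g = g] summable_on_SigmaI[where g = g])
    (auto intro: has_sum_imp_summable)

lemma has_sum_product_nonneg:
  fixes f :: "'a \<Rightarrow> real" and g :: "'b \<Rightarrow> real"
  assumes "(f has_sum a) A" "(g has_sum b) B"
    and "\<And>x. x \<in> A \<Longrightarrow> 0 \<le> f x" "\<And>y. y \<in> B \<Longrightarrow> 0 \<le> g y"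
  shows "((\<lambda>(x, y). f x * g y) has_sum (a * b)) (A \<times> B)"
  using assms by (intro has_sum_Sigma_nonneg[where g = "\<lambda>x. f x * b"])
    (auto intro: has_sum_cmult_right has_sum_cmult_left)

lemma has_sum_fibers:
  fixes f :: "'a \<Rightarrow> real"
  assumes "(f has_sum T) D" and "\<And>z. z \<in> D \<Longrightarrow> d z \<in> I"
  shows "((\<lambda>i. \<Sum>\<^sub>\<infinity>z\<in>{z\<in>D. d z = i}. f z) has_sum T) I"
proof -
  have "((\<lambda>(i, z). f z) has_sum T) (Sigma I (\<lambda>i. {z \<in> D. d z = i}))"
    using assms
    by (subst has_sum_reindex_bij_witness[where i = "\<lambda>z. (d z, z)" and j = snd and T = D and h = f]) auto
  then show ?thesis
    by (rule has_sum_SigmaD) (auto intro!: has_sum_infsum summable_on_subset_banach[OF has_sum_imp_summable[OF assms(1)]])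
qed

text \<open>A one-sided identity theorem, since the generating functions are compared at positive
  arguments only. Once the coefficients below \<open>i\<close> vanish, division by
  \<open>x ^ i\<close> and the limit from the right isolate \<open>c i\<close>.\<close>

lemma power_series_eq_zero_at_right:
  fixes c :: "nat \<Rightarrow> real"
  assumes "0 < \<epsilon>" and sums: "\<And>x. 0 < x \<Longrightarrow> x < \<epsilon> \<Longrightarrow> (\<lambda>i. c i * x ^ i) sums 0"
  shows "c i = 0"
proof (induction i rule: less_induct)
  case (less i)
  have z: "(\<lambda>k. c (k + i) * x ^ k) sums 0" if x: "0 < x" "x < \<epsilon>" for x
  proof -
    have "(\<lambda>k. c (k + i) * x ^ (k + i)) sums (0 - (\<Sum>k<i. c k * x ^ k))"
      using sums[OF x] by (subst sums_iff_shift) simp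
    moreover have "(\<Sum>k<i. c k * x ^ k) = 0"
      using less by simp
    ultimately have "(\<lambda>k. x ^ i * (c (k + i) * x ^ k)) sums (x ^ i * 0)"
      by (simp add: power_add mult_ac)
    then show ?thesis
      by (subst (asm) sums_mult_iff) (use x in auto)
  qed
  \<comment> \<open>Convergence at \<open>\<epsilon> / 2\<close> makes the shifted series continuous
    inside the disc of that radius, in particular at 0.\<close>
  have "isCont (\<lambda>x. \<Sum>k. c (k + i) * x ^ k) 0"
    by (rule isCont_powser[where K = "\<epsilon> / 2"]) (use z[of "\<epsilon>/2"] assms(1) in \<open>auto simp: sums_iff\<close>)
  then have "((\<lambda>x. \<Sum>k. c (k + i) * x ^ k) \<longlongrightarrow> c i) (at_right 0)"
    unfolding isCont_def by (auto intro: tendsto_mono[OF at_le] simp: powser_zero)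
  moreover have "\<forall>\<^sub>F x in at_right 0. (\<Sum>k. c (k + i) * x ^ k) = 0"
    unfolding eventually_at_right_field using assms(1) z by (auto simp: sums_iff intro!: exI[of _ \<epsilon>])
  ultimately have "((\<lambda>x. 0) \<longlongrightarrow> c i) (at_right (0::real))"
    using tendsto_cong by fast
  then show "c i = 0"
    by (simp add: tendsto_const_iff)
qed

text \<open>Grouping by the exponent turns the family into a power series in \<open>x\<close>.
  Summability at a single positive argument already makes each coefficient family summable.\<close>

lemma has_sum_by_degree:
  fixes f :: "'a \<Rightarrow> real"
  assumes "((\<lambda>z. f z * x ^ d z) has_sum T) D" "0 < x"
  shows "f summable_on {z\<in>D. d z = i}"
    and "(\<lambda>i. (\<Sum>\<^sub>\<infinity>z\<in>{z\<in>D. d z = i}. f z) * x ^ i) sums T"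
proof -
  have "(\<lambda>z. f z * x ^ d z) summable_on {z\<in>D. d z = i}" for i
    by (rule summable_on_subset_banach[OF has_sum_imp_summable[OF assms(1)]]) auto
  then have "(\<lambda>z. f z * x ^ i) summable_on {z\<in>D. d z = i}" for i
    by (rule summable_on_cong[THEN iffD1, rotated]) simp
  then show sm: "f summable_on {z\<in>D. d z = i}" for i
    using assms(2) by (subst (asm) summable_on_cmult_left') auto
  have "((\<lambda>i. \<Sum>\<^sub>\<infinity>z\<in>{z\<in>D. d z = i}. f z * x ^ d z) has_sum T) UNIV"
    by (rule has_sum_fibers[OF assms(1)]) auto
  moreover have "(\<Sum>\<^sub>\<infinity>z\<in>{z\<in>D. d z = i}. f z * x ^ d z) = (\<Sum>\<^sub>\<infinity>z\<in>{z\<in>D. d z = i}. f z) * x ^ i" for i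
  proof -
    have "(\<Sum>\<^sub>\<infinity>z\<in>{z\<in>D. d z = i}. f z * x ^ d z) = (\<Sum>\<^sub>\<infinity>z\<in>{z\<in>D. d z = i}. f z * x ^ i)"
      by (rule infsum_cong) auto
    then show ?thesis using sm by (simp add: infsum_cmult_left)
  qed
  ultimately show "(\<lambda>i. (\<Sum>\<^sub>\<infinity>z\<in>{z\<in>D. d z = i}. f z) * x ^ i) sums T"
    by (simp add: has_sum_imp_sums)
qed

text \<open>Hypothesis and conclusion have the same shape, a common sum of two families, so the
  lemma can be iterated over several variables.\<close>

lemma has_sum_coefficients_eq:
  fixes f :: "'a \<Rightarrow> real" and g :: "'b \<Rightarrow> real"
  assumes "0 < \<epsilon>"
    and ex: "\<And>x. 0 < x \<Longrightarrow> x < \<epsilon> \<Longrightarrow>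
      \<exists>T. ((\<lambda>z. f z * x ^ d z) has_sum T) D \<and> ((\<lambda>z. g z * x ^ e z) has_sum T) E"
  shows "\<exists>T. (f has_sum T) {z\<in>D. d z = i} \<and> (g has_sum T) {z\<in>E. e z = i}"
proof -
  let ?F = "\<lambda>i. \<Sum>\<^sub>\<infinity>z\<in>{z\<in>D. d z = i}. f z" and ?G = "\<lambda>i. \<Sum>\<^sub>\<infinity>z\<in>{z\<in>E. e z = i}. g z"
  have "?F i - ?G i = 0"
  proof (rule power_series_eq_zero_at_right[OF assms(1)])
    fix x assume x: "0 < x" "x < \<epsilon>"
    from ex[OF x] obtain T where "((\<lambda>z. f z * x ^ d z) has_sum T) D" "((\<lambda>z. g z * x ^ e z) has_sum T) E"
      by blast
    from sums_diff[OF this[THEN has_sum_by_degree(2), OF x(1)]]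
    show "(\<lambda>i. (?F i - ?G i) * x ^ i) sums 0"
      by (simp add: left_diff_distrib)
  qed
  moreover have "f summable_on {z\<in>D. d z = i}" "g summable_on {z\<in>E. e z = i}"
    using ex[of "\<epsilon>/2"] assms(1) by (auto dest!: has_sum_by_degree(1)[where x = "\<epsilon>/2"])
  ultimately show ?thesis
    by (intro exI[of _ "?F i"]) (simp add: has_sum_iff)
qed

section \<open>A connected sum\<close>

text \<open>The rising factorial of length \<open>n\<close> starting at 1 - x; for x < 1 it is
  Gamma(n + 1 - x) / Gamma(1 - x).\<close>

definition shifted_prod :: "nat \<Rightarrow> real \<Rightarrow> real"
  where "shifted_prod n x = (\<Prod>a=1..n. real a - x)"

lemma shifted_prod_0 [simp]: "shifted_prod 0 x = 1"
  by (simp add: shifted_prod_def)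

lemma shifted_prod_Suc: "shifted_prod (Suc n) x = shifted_prod n x * (real (Suc n) - x)"
  by (simp add: shifted_prod_def)

lemma shifted_prod_pos: "x < 1 \<Longrightarrow> 0 < shifted_prod n x"
  by (auto simp: shifted_prod_def intro!: prod_pos)

lemma shifted_prod_add: "shifted_prod (n + m) x = shifted_prod n x * shifted_prod m (x - real n)"
  by (induction m) (simp_all add: shifted_prod_Suc algebra_simps)

lemma has_sum_from_1_iff:
  fixes f :: "nat \<Rightarrow> 'a :: {topological_comm_monoid_add, t2_space}"
  shows "(f has_sum T) {1..} \<longleftrightarrow> ((\<lambda>j. f (Suc j)) has_sum T) UNIV"
  by (rule has_sum_reindex_bij_witness[of _ Suc "\<lambda>n. n - 1"]) auto

text \<open>The differences of a decreasing positive sequence have a finite sum. A positive limit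
  would bound them below by a multiple of 1/(j + K), contradicting the divergence of the harmonic
  series.\<close>

lemma tendsto_0_if_harmonic_decay:
  fixes c :: "nat \<Rightarrow> real"
  assumes pos: "\<And>j. 0 < c j" and "0 < \<delta>" "0 < \<eta>"
    and step: "\<And>j. c j - c (Suc j) = \<delta> * c j / (real j + \<eta>)"
  shows "c \<longlonglongrightarrow> 0"
proof -
  have le: "c (Suc j) \<le> c j" for j
  proof -
    have "0 \<le> \<delta> * c j / (real j + \<eta>)"
      using assms by (intro divide_nonneg_pos mult_nonneg_nonneg less_imp_le[OF pos]) (auto intro: add_nonneg_pos)
    then show ?thesis using step[of j] by linarith
  qed
  then have dec: "decseq c" by (rule decseq_SucI)
  then obtain L where L: "c \<longlonglongrightarrow> L" "\<And>j. L \<le> c j"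
    using decseq_convergent[OF dec, of 0] pos by (metis less_imp_le)
  have "L \<le> 0"
  proof (rule ccontr)
    assume "\<not> L \<le> 0"
    then have "0 < L" by simp
    obtain K :: nat where K: "\<eta> \<le> real K" using real_arch_simple by blast
    have "summable (\<lambda>j. c j - c (Suc j))"
      using telescope_sums'[OF L(1)] by (auto simp: sums_iff)
    moreover have "\<delta> * L * inverse (real (j + K)) \<le> c j - c (Suc j)" if "1 \<le> j" for j
    proof -
      have "\<delta> * L / real (j + K) \<le> \<delta> * c j / (real j + \<eta>)"
        using \<open>0 < L\<close> \<open>0 < \<delta>\<close> \<open>0 < \<eta>\<close> K L(2)[of j] that by (intro frac_le mult_left_mono mult_nonneg_nonneg) auto
      then show ?thesis by (simp add: step divide_inverse)
    qed
    ultimately have "summable (\<lambda>j. \<delta> * L * inverse (real (j + K)))"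
      using \<open>0 < L\<close> \<open>0 < \<delta>\<close>
      by (intro summable_comparison_test[where f = "\<lambda>j. \<delta> * L * inverse (real (j + K))"])
        (auto intro!: exI[of _ 1])
    then have "summable (\<lambda>j. inverse (real (j + K)))"
      using \<open>0 < L\<close> \<open>0 < \<delta>\<close> by (subst (asm) summable_cmult_iff) auto
    then show False
      using summable_iff_shift[of "\<lambda>j. inverse (real j)" K] not_summable_harmonic[where 'a = real] by simp
  qed
  moreover have "0 \<le> L" using L(1) pos by (meson LIMSEQ_le_const less_imp_le)
  ultimately show ?thesis using L(1) by simp
qed

lemma has_sum_telescope_harmonic_decay:
  fixes c :: "nat \<Rightarrow> real"
  assumes pos: "\<And>j. 0 < c j" and "0 < \<delta>" "0 < \<eta>"
    and step: "\<And>j. c j - c (Suc j) = \<delta> * c j / (real j + \<eta>)"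
  shows "((\<lambda>m. c (m - 1) - c m) has_sum c N) {N<..}"
proof -
  have "(\<lambda>j. c (j + N)) \<longlonglongrightarrow> 0"
    by (rule LIMSEQ_ignore_initial_segment[OF tendsto_0_if_harmonic_decay[OF assms]])
  from telescope_sums'[OF this]
  have "(\<lambda>j. c (j + N) - c (Suc j + N)) sums c N" by simp
  moreover have "0 \<le> c (j + N) - c (Suc j + N)" for j
    using step[of "j + N"] assms(2,3) less_imp_le[OF pos]
    by (auto intro!: divide_nonneg_pos mult_nonneg_nonneg add_nonneg_pos)
  ultimately have "((\<lambda>j. c (j + N) - c (Suc j + N)) has_sum c N) UNIV"
    by (rule sums_nonneg_imp_has_sum)
  then show ?thesis
    by (subst has_sum_reindex_bij_witness[of _ "\<lambda>j. Suc (j + N)" "\<lambda>m. m - Suc N" UNIV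
          "\<lambda>j. c (j + N) - c (Suc j + N)"]) auto
qed

lemma summable_on_inverse_product:
  fixes a b :: real
  assumes "a < 1" "b < 1"
  shows "(\<lambda>n. 1 / ((real n - a) * (real n - b))) summable_on {1..}"
proof -
  \<comment> \<open>A slope for which n - a and n - b are at least k n for all n >= 1; this reduces
    the claim to the series of 1/n^2.\<close>
  define k where "k = min 1 (min (1 - a) (1 - b))"
  have k: "0 < k" using assms by (simp add: k_def)
  have bd: "k * real n \<le> real n - x" if "1 \<le> n" "k \<le> 1" "k \<le> 1 - x" for n and x :: real
  proof -
    have "0 \<le> (1 - k) * (real n - 1)" using that by simp
    then have "k * real n \<le> real n - (1 - k)" by (simp add: algebra_simps)
    then show ?thesis using that by linarith
  qed
  have "(\<lambda>n. 1 / real n ^ 2) summable_on UNIV"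
    using inverse_power_summable[of 2, where 'a = real]
    by (intro summable_nonneg_imp_summable_on) (auto simp: field_simps)
  from summable_on_subset_banach[OF this, of "{1..}"]
  have "(\<lambda>n. 1 / k ^ 2 * (1 / real n ^ 2)) summable_on {1..}"
    by (intro summable_on_cmult_right) simp
  then show ?thesis
  proof (rule summable_on_comparison_test)
    fix n :: nat assume n: "n \<in> {1..}"
    have "0 < k * real n" using k n by simp
    moreover have "k * real n \<le> real n - a" "k * real n \<le> real n - b"
      using n by (intro bd; simp add: k_def)+
    ultimately have "1 / ((real n - a) * (real n - b)) \<le> 1 / ((k * real n) * (k * real n))"
      using k n assms by (intro divide_left_mono mult_mono mult_pos_pos) auto
    then show "1 / ((real n - a) * (real n - b)) \<le> 1 / k ^ 2 * (1 / real n ^ 2)"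
      by (simp add: power2_eq_square mult_ac)
    show "0 \<le> 1 / ((real n - a) * (real n - b))"
      using assms n by (intro divide_nonneg_nonneg mult_nonneg_nonneg) auto
  qed
qed

text \<open>A connected sum: \<open>Q m n\<close> is a difference of the connector \<open>c m n\<close> in either variable, up to
  a factor depending on the other variable only.\<close>

lemma shifted_prod_transformation:
  fixes x y :: real
  assumes "x < 1" "y < 1" "y - x < 1"
  shows "\<exists>V. ((\<lambda>n. shifted_prod N x * shifted_prod n y /
                   (shifted_prod (N + n) y * ((real n - (y - x)) * (real n - y)))) has_sum V) {1..} \<and>
             ((\<lambda>m. shifted_prod (m - 1) x / (real m * shifted_prod m y)) has_sum V) {N<..}"
proof -
  define c where "c m n = shifted_prod m x * shifted_prod n y / shifted_prod (m + n) y" for m n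
  define Q where "Q m n = shifted_prod (m - 1) x * shifted_prod (n - 1) y / shifted_prod (m + n) y" for m n
  note pos = shifted_prod_pos[OF assms(1)] shifted_prod_pos[OF assms(2)]
  have cpos: "0 < c m n" for m n
    by (simp add: c_def pos)
  have Qpos: "0 < Q m n" for m n
    by (simp add: Q_def pos)
  have step1: "c j n - c (Suc j) n = (real n - (y - x)) * c j n / (real j + (real n + 1 - y))" for j n
    using assms pos[of "j + n"]
    by (simp add: c_def shifted_prod_Suc divide_simps del: of_nat_add) (simp add: algebra_simps)
  have step2: "c m j - c m (Suc j) = real m * c m j / (real j + (real m + 1 - y))" for j m
    using assms pos[of "m + j"]
    by (simp add: c_def shifted_prod_Suc divide_simps del: of_nat_add) (simp add: algebra_simps)
  have Q1: "c (m - 1) n - c m n = (real n - (y - x)) * (real n - y) * Q m n" if mn: "1 \<le> m" "1 \<le> n" for m n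
  proof -
    obtain i j where ij: "m = Suc i" "n = Suc j" using mn by (metis Suc_le_D One_nat_def)
    show ?thesis using assms pos[of "i + j"]
      by (simp add: ij c_def Q_def shifted_prod_Suc divide_simps del: of_nat_add) (simp add: algebra_simps)
  qed
  have Q2: "c m (n - 1) - c m n = real m * (real m - x) * Q m n" if mn: "1 \<le> m" "1 \<le> n" for m n
  proof -
    obtain i j where ij: "m = Suc i" "n = Suc j" using mn by (metis Suc_le_D One_nat_def)
    show ?thesis using assms pos[of "i + j"]
      by (simp add: ij c_def Q_def shifted_prod_Suc divide_simps del: of_nat_add) (simp add: algebra_simps)
  qed
  \<comment> \<open>The connector decreases in its second argument, so \<open>c N 0\<close>
    dominates and the series that defines \<open>V\<close> converges.\<close>
  have c_le: "c N n \<le> c N 0" for n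
  proof (induction n)
    case (Suc n)
    have "0 \<le> real N * c N n / (real n + (real N + 1 - y))"
      using assms less_imp_le[OF cpos] by (intro divide_nonneg_pos mult_nonneg_nonneg) auto
    then show ?case using step2[of N n] Suc by linarith
  qed simp
  have "(\<lambda>n. c N 0 * (1 / ((real n - (y - x)) * (real n - y)))) summable_on {1..}"
    using assms by (intro summable_on_cmult_right summable_on_inverse_product)
  then have "(\<lambda>n. c N n * (1 / ((real n - (y - x)) * (real n - y)))) summable_on {1..}"
  proof (rule summable_on_comparison_test)
    fix n :: nat assume "n \<in> {1..}"
    then have "0 \<le> 1 / ((real n - (y - x)) * (real n - y))"
      using assms by (intro divide_nonneg_nonneg mult_nonneg_nonneg) auto
    then show "c N n * (1 / ((real n - (y - x)) * (real n - y))) \<le> c N 0 * (1 / ((real n - (y - x)) * (real n - y)))"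
      "0 \<le> c N n * (1 / ((real n - (y - x)) * (real n - y)))"
      using cpos[of N n] c_le[of n] by (auto intro: mult_right_mono mult_nonneg_nonneg simp del: times_divide_eq_right)
  qed
  then obtain V where V: "((\<lambda>n. c N n * (1 / ((real n - (y - x)) * (real n - y)))) has_sum V) {1..}"
    by (auto simp: summable_on_def)
  have Vm: "((\<lambda>m. Q m n) has_sum c N n * (1 / ((real n - (y - x)) * (real n - y)))) {N<..}" if n: "n \<in> {1..}" for n
  proof -
    have "((\<lambda>m. c (m - 1) n - c m n) has_sum c N n) {N<..}"
      using assms n by (intro has_sum_telescope_harmonic_decay[OF cpos _ _ step1]) auto
    then have "((\<lambda>m. (real n - (y - x)) * (real n - y) * Q m n) has_sum c N n) {N<..}"
      by (subst (asm) has_sum_cong[where g = "\<lambda>m. (real n - (y - x)) * (real n - y) * Q m n"])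
        (use n Q1[of _ n] in auto)
    from has_sum_cmult_right[OF this, of "1 / ((real n - (y - x)) * (real n - y))"] show ?thesis
      using assms n by (simp add: mult_ac)
  qed
  \<comment> \<open>Summed over \<open>m\<close> first, the double sum of \<open>Q\<close>
    telescopes in the first argument of the connector and gives \<open>V\<close>. Summed over
    \<open>n\<close> first, it telescopes in the second argument down to \<open>c m 0\<close>, which
    gives the other side of the claim.\<close>
  have "((\<lambda>(n, m). Q m n) has_sum V) ({1..} \<times> {N<..})"
    by (rule has_sum_Sigma_nonneg[OF _ V]) (use Vm in \<open>auto intro: less_imp_le[OF Qpos]\<close>)
  then have "((\<lambda>(m, n). Q m n) has_sum V) ({N<..} \<times> {1..})"
    by (subst (asm) has_sum_swap) (simp add: case_prod_unfold)
  then have "((\<lambda>m. c m 0 * (1 / (real m * (real m - x)))) has_sum V) {N<..}"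
  proof (rule has_sum_SigmaD)
    fix m assume m: "m \<in> {N<..}"
    have "((\<lambda>n. c m (n - 1) - c m n) has_sum c m 0) {0<..}"
      using assms m by (intro has_sum_telescope_harmonic_decay[OF cpos _ _ step2]) auto
    then have "((\<lambda>n. real m * (real m - x) * Q m n) has_sum c m 0) {1..}"
      by (subst (asm) has_sum_cong[where g = "\<lambda>n. real m * (real m - x) * Q m n"])
        (use m Q2[of m] in \<open>auto simp: atLeast_Suc_greaterThan\<close>)
    from has_sum_cmult_right[OF this, of "1 / (real m * (real m - x))"]
    show "((\<lambda>n. case (m, n) of (m, n) \<Rightarrow> Q m n) has_sum c m 0 * (1 / (real m * (real m - x)))) {1..}"
      using assms m by (simp add: mult_ac)
  qed
  moreover have "c m 0 * (1 / (real m * (real m - x))) = shifted_prod (m - 1) x / (real m * shifted_prod m y)"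
    if m: "m \<in> {N<..}" for m
  proof -
    obtain i where "m = Suc i" using m by (cases m) auto
    then show ?thesis using assms pos[of "Suc i"]
      by (simp add: c_def shifted_prod_Suc divide_simps del: of_nat_Suc)
  qed
  ultimately have "((\<lambda>m. shifted_prod (m - 1) x / (real m * shifted_prod m y)) has_sum V) {N<..}"
    by (subst (asm) has_sum_cong) auto
  moreover have "((\<lambda>n. shifted_prod N x * shifted_prod n y /
                   (shifted_prod (N + n) y * ((real n - (y - x)) * (real n - y)))) has_sum V) {1..}"
    using V by (simp add: c_def)
  ultimately show ?thesis by blast
qed

text \<open>Transforming the inner sum over m > N cancels \<open>shifted_prod N x\<close>. The sum
  over N that is left is of the same kind, with y replaced by y - n and lower bound 0, and can be
  transformed once more. Both sides therefore equal the double sum of the intermediate family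
  \<open>g\<close>.\<close>

lemma shifted_prod_double_transformation:
  fixes x x' y :: real
  assumes "x < 1" "x' < 1" "y < 1" "y - x < 1" "y - x' < 1"
  shows "\<exists>W. ((\<lambda>(N, m). shifted_prod (N - 1) x' / (real N * shifted_prod N x) *
                (shifted_prod (m - 1) x / (real m * shifted_prod m y))) has_sum W) (SIGMA N:{1..}. {N<..}) \<and>
             ((\<lambda>(n, m). 1 / ((real n - (y - x)) * (real n - y)) *
                (1 / ((real m - (y - x')) * (real m - y)))) has_sum W) (SIGMA n:{1..}. {n<..})"
proof -
  define p where "p n = 1 / ((real n - (y - x)) * (real n - y))" for n :: nat
  define q where "q n = 1 / ((real n - (y - x')) * (real n - y))" for n :: nat
  note pos = shifted_prod_pos[OF assms(1)] shifted_prod_pos[OF assms(2)] shifted_prod_pos[OF assms(3)]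
  have p0: "0 \<le> p n" and q0: "0 \<le> q n" if "1 \<le> n" for n
    using assms that by (auto simp: p_def q_def)
  obtain a b where "(p has_sum a) {1..}" "(q has_sum b) {1..}"
    using summable_on_inverse_product[of "y - x" y] summable_on_inverse_product[of "y - x'" y] assms
    unfolding p_def q_def summable_on_def by auto
  then have "((\<lambda>(n, m). p n * q m) has_sum (a * b)) ({1..} \<times> {1..})"
    by (rule has_sum_product_nonneg) (auto intro: p0 q0)
  then have "(\<lambda>(n, m). p n * q m) summable_on (SIGMA n:{1..}. {n<..})"
    by (rule summable_on_subset_banach[OF has_sum_imp_summable]) auto
  then obtain W where W: "((\<lambda>(n, m). p n * q m) has_sum W) (SIGMA n:{1..}. {n<..})"
    by (auto simp: summable_on_def)
  define g where "g n N = p n * (shifted_prod n y * shifted_prod (N - 1) x' / (real N * shifted_prod (N + n) y))"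
    for n N :: nat
  have g0: "0 \<le> g n N" if "1 \<le> n" for n N
    using that p0 pos[THEN less_imp_le] by (simp add: g_def)
  have inner: "\<exists>v. (q has_sum v) {n<..} \<and> ((\<lambda>N. g n N) has_sum (p n * v)) {1..}" if n: "n \<in> {1..}" for n
  proof -
    \<comment> \<open>The shift of y by n turns the index k of the transformation into n + k, whence
      the range m > n.\<close>
    obtain V where V: "((\<lambda>k. shifted_prod 0 x' * shifted_prod k (y - real n) / (shifted_prod (0 + k) (y - real n)
          * ((real k - (y - real n - x')) * (real k - (y - real n))))) has_sum V) {1..}"
      "((\<lambda>m. shifted_prod (m - 1) x' / (real m * shifted_prod m (y - real n))) has_sum V) {0<..}"
      using shifted_prod_transformation[of x' "y - real n" 0] assms n by auto
    have pn: "0 < shifted_prod k (y - real n)" for k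
      using assms n by (intro shifted_prod_pos) auto
    have "real k - (y - real n - x') = real (n + k) - (y - x')" "real k - (y - real n) = real (n + k) - y" for k
      by simp_all
    with V(1) pn[THEN less_imp_neq, symmetric] have "((\<lambda>k. q (n + k)) has_sum V) {1..}"
      by (simp add: q_def)
    then have "(q has_sum V) {n<..}"
      by (subst has_sum_reindex_bij_witness[of _ "\<lambda>k. n + k" "\<lambda>m. m - n" "{1..}" "\<lambda>k. q (n + k)"]) auto
    moreover have "((\<lambda>N. p n * (shifted_prod (N - 1) x' / (real N * shifted_prod N (y - real n)))) has_sum (p n * V)) {1..}"
      using V(2) by (intro has_sum_cmult_right) (simp add: atLeast_Suc_greaterThan)
    then have "((\<lambda>N. g n N) has_sum (p n * V)) {1..}"
      by (rule has_sum_cong[THEN iffD1, rotated])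
        (use pos(3)[of n] in \<open>simp add: g_def add.commute[of _ n] shifted_prod_add\<close>)
    ultimately show ?thesis by blast
  qed
  have "((\<lambda>n. p n * (\<Sum>\<^sub>\<infinity>m\<in>{n<..}. q m)) has_sum W) {1..}"
  proof (rule has_sum_SigmaD[OF W])
    fix n :: nat assume "n \<in> {1..}"
    then show "((\<lambda>m. case (n, m) of (n, m) \<Rightarrow> p n * q m) has_sum p n * (\<Sum>\<^sub>\<infinity>m\<in>{n<..}. q m)) {n<..}"
      using inner[of n] by (auto dest: infsumI intro: has_sum_cmult_right)
  qed
  then have "((\<lambda>(n, N). g n N) has_sum W) ({1..} \<times> {1..})"
    by (rule has_sum_Sigma_nonneg[rotated]) (use inner g0 in \<open>auto simp: has_sum_iff\<close>)
  then have G: "((\<lambda>(N, n). g n N) has_sum W) ({1..} \<times> {1..})"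
    by (subst (asm) has_sum_swap) (simp add: case_prod_unfold)
  define h where "h N = shifted_prod (N - 1) x' / (real N * shifted_prod N x)" for N
  define k where "k m = shifted_prod (m - 1) x / (real m * shifted_prod m y)" for m
  have h0: "0 \<le> h N" and k0: "0 \<le> k N" for N
    using pos[THEN less_imp_le] by (auto simp: h_def k_def)
  have inner': "\<exists>v. (k has_sum v) {N<..} \<and> ((\<lambda>n. g n N) has_sum (h N * v)) {1..}" for N
  proof -
    obtain V where V: "((\<lambda>n. shifted_prod N x * shifted_prod n y /
                   (shifted_prod (N + n) y * ((real n - (y - x)) * (real n - y)))) has_sum V) {1..}"
             "(k has_sum V) {N<..}"
      using shifted_prod_transformation[of x y N] assms unfolding k_def by auto
    have "((\<lambda>n. h N * (shifted_prod N x * shifted_prod n y /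
                   (shifted_prod (N + n) y * ((real n - (y - x)) * (real n - y))))) has_sum (h N * V)) {1..}"
      by (intro has_sum_cmult_right V)
    then have "((\<lambda>n. g n N) has_sum (h N * V)) {1..}"
      by (rule has_sum_cong[THEN iffD1, rotated])
        (use pos(1)[of N] in \<open>simp add: g_def h_def p_def mult_ac\<close>)
    with V(2) show ?thesis by blast
  qed
  have "((\<lambda>N. h N * (\<Sum>\<^sub>\<infinity>m\<in>{N<..}. k m)) has_sum W) {1..}"
    using G by (rule has_sum_SigmaD) (use inner' in \<open>auto simp: has_sum_iff\<close>)
  then have "((\<lambda>(N, m). h N * k m) has_sum W) (SIGMA N:{1..}. {N<..})"
  proof (rule has_sum_Sigma_nonneg[rotated])
    fix N :: nat
    show "((\<lambda>m. case (N, m) of (N, m) \<Rightarrow> h N * k m) has_sum h N * (\<Sum>\<^sub>\<infinity>m\<in>{N<..}. k m)) {N<..}"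
      using inner'[of N] by (auto dest: infsumI intro: has_sum_cmult_right)
  qed (auto simp: h0 k0)
  with W show ?thesis unfolding h_def k_def p_def q_def by blast
qed

section \<open>Expansion of a rational function in three variables\<close>

lemma sums_negative_binomial:
  fixes x :: real
  assumes "\<bar>x\<bar> < 1"
  shows "(\<lambda>s. real ((s + k) choose s) * x ^ s) sums (1 / (1 - x) ^ Suc k)"
proof -
  have "(- real (Suc k) gchoose s) * (- x) ^ s = real ((s + k) choose s) * x ^ s" for s
  proof -
    have "(real (Suc k) + real s - 1 gchoose s) = real ((s + k) choose s)"
      by (simp add: binomial_gbinomial add_ac)
    moreover have "(- x) ^ s = (- 1) ^ s * x ^ s" by (rule power_minus)
    ultimately show ?thesis
      unfolding gbinomial_minus by (simp add: mult_ac flip: power_mult_distrib)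
  qed
  moreover have "(1 + - x) powr (- real (Suc k)) = 1 / (1 - x) ^ Suc k"
    using assms by (subst powr_minus, subst powr_realpow) (auto simp: divide_inverse)
  ultimately show ?thesis
    using gen_binomial_real[of "- x" "- real (Suc k)"] assms by simp
qed

text \<open>With z = 1/(1 - x) the right-hand side is z^2 / ((1 - z y) (1 - z t)). Two geometric
  series produce the power z^(\<rho> + e + 2), and the negative binomial series in x produces the
  binomial coefficient.\<close>

lemma has_sum_binomial_series:
  fixes x y t :: real
  assumes "0 \<le> x" "0 \<le> y" "0 \<le> t" "x + y < 1" "x + t < 1"
  shows "((\<lambda>(\<rho>, e, s). real ((s + (\<rho> + e + 1)) choose s) * x ^ s * y ^ \<rho> * t ^ e)
    has_sum (1 / ((1 - (x + y)) * (1 - (x + t))))) UNIV"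
proof -
  define z where "z = 1 / (1 - x)"
  have x: "x < 1" using assms by linarith
  have geo: "((\<lambda>i. (z * u) ^ i) has_sum (1 / (1 - z * u))) UNIV" if "0 \<le> u" "x + u < 1" for u
  proof -
    have "z * u < 1" "0 \<le> z * u"
      using that x by (auto simp: z_def field_simps)
    then show ?thesis
      by (intro sums_nonneg_imp_has_sum geometric_sums) auto
  qed
  have "((\<lambda>s. y ^ \<rho> * t ^ e * (real ((s + (\<rho> + e + 1)) choose s) * x ^ s)) has_sum y ^ \<rho> * t ^ e * z ^ Suc (\<rho> + e + 1)) UNIV" for \<rho> e
    using sums_negative_binomial[of x "\<rho> + e + 1"] x assms
    by (intro has_sum_cmult_right sums_nonneg_imp_has_sum) (auto simp: z_def power_one_over)
  moreover have "((\<lambda>e. (z * y) ^ \<rho> * z\<^sup>2 * (z * t) ^ e) has_sum (z * y) ^ \<rho> * z\<^sup>2 * (1 / (1 - z * t))) UNIV" for \<rho>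
    using assms by (intro has_sum_cmult_right geo)
  moreover have "(z * y) ^ \<rho> * z\<^sup>2 * (z * t) ^ e = y ^ \<rho> * t ^ e * z ^ Suc (\<rho> + e + 1)" for \<rho> e
    by (simp add: power_mult_distrib power2_eq_square power_add mult_ac)
  ultimately have "((\<lambda>(e, s). y ^ \<rho> * t ^ e * (real ((s + (\<rho> + e + 1)) choose s) * x ^ s))
      has_sum (z * y) ^ \<rho> * z\<^sup>2 * (1 / (1 - z * t))) (UNIV \<times> UNIV)" for \<rho>
    using assms by (intro has_sum_Sigma_nonneg) auto
  moreover have "((\<lambda>\<rho>. z\<^sup>2 * (1 / (1 - z * t)) * (z * y) ^ \<rho>) has_sum z\<^sup>2 * (1 / (1 - z * t)) * (1 / (1 - z * y))) UNIV"
    using assms by (intro has_sum_cmult_right geo)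
  ultimately have "((\<lambda>(\<rho>, e, s). y ^ \<rho> * t ^ e * (real ((s + (\<rho> + e + 1)) choose s) * x ^ s))
      has_sum z\<^sup>2 * (1 / (1 - z * t)) * (1 / (1 - z * y))) (UNIV \<times> UNIV)"
    using assms by (intro has_sum_Sigma_nonneg[where g = "\<lambda>\<rho>. z\<^sup>2 * (1 / (1 - z * t)) * (z * y) ^ \<rho>"]) (auto simp: mult_ac)
  moreover have "z\<^sup>2 * (1 / (1 - z * t)) * (1 / (1 - z * y)) = 1 / ((1 - (x + y)) * (1 - (x + t)))"
    using assms x by (simp add: z_def divide_simps power2_eq_square) (auto simp: algebra_simps)
  ultimately show ?thesis
    by (simp add: mult_ac case_prod_unfold)
qed

section \<open>Generating functions of blocks\<close>

text \<open>A letter \<open>(a, k)\<close> encodes a factor \<open>1 / a\<^sup>k\<close>; in its weight, \<open>u\<close> marks the letter and \<open>t\<close> the excess \<open>k - 1\<close>.\<close>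

definition strict_words :: "nat \<Rightarrow> nat \<Rightarrow> (nat \<times> nat) list set"
  where "strict_words N m =
    {zs. sorted_wrt (<) (map fst zs) \<and> (\<forall>(a, k)\<in>set zs. N < a \<and> a < m \<and> 0 < k)}"

definition weak_words :: "nat \<Rightarrow> (nat \<times> nat) list set"
  where "weak_words m =
    {zs. sorted_wrt (\<le>) (map fst zs) \<and> (\<forall>(b, k)\<in>set zs. 0 < b \<and> b \<le> m \<and> 0 < k)}"

definition word_weight :: "real \<Rightarrow> real \<Rightarrow> (nat \<times> nat) list \<Rightarrow> real"
  where "word_weight u t zs = (\<Prod>(a, k)\<leftarrow>zs. u * t ^ (k - 1) / real a ^ k)"

lemma word_weight_Nil [simp]: "word_weight u t [] = 1"
  by (simp add: word_weight_def)

lemma word_weight_append [simp]: "word_weight u t (xs @ ys) = word_weight u t xs * word_weight u t ys"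
  by (simp add: word_weight_def)

lemma word_weight_nonneg: "0 \<le> u \<Longrightarrow> 0 \<le> t \<Longrightarrow> 0 \<le> word_weight u t zs"
  unfolding word_weight_def by (rule prod_list_nonneg) auto

lemma has_sum_letter:
  fixes u t :: real
  assumes "0 \<le> u" "0 \<le> t" "t < 1" "0 < a"
  shows "((\<lambda>k. u * t ^ (k - 1) / real a ^ k) has_sum (u / (real a - t))) {0<..}"
proof -
  have q: "0 \<le> t / real a" "t / real a < 1" using assms by (auto simp: field_simps)
  have "((\<lambda>j. u / real a * (t / real a) ^ j) has_sum u / real a * (1 / (1 - t / real a))) UNIV"
    using q by (intro has_sum_cmult_right sums_nonneg_imp_has_sum geometric_sums) auto
  moreover have "u / real a * (1 / (1 - t / real a)) = u / (real a - t)"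
    using assms by (simp add: field_simps)
  ultimately show ?thesis
    by (subst has_sum_reindex_bij_witness[of _ Suc "\<lambda>k. k - 1" UNIV "\<lambda>j. u / real a * (t / real a) ^ j"])
      (auto simp: power_divide gr0_conv_Suc)
qed

text \<open>Each integer a with N < a <= N + j either is absent or carries exactly one letter, so it
  contributes 1 + u/(a - t) = (a - (t - u))/(a - t). The quotients of \<open>shifted_prod\<close>
  are the product of these factors.\<close>

lemma has_sum_strict_words:
  fixes u t :: real
  assumes "0 \<le> u" "0 \<le> t" "t < 1"
  shows "((word_weight u t) has_sum
    (shifted_prod (N + j) (t - u) / shifted_prod N (t - u) * (shifted_prod N t / shifted_prod (N + j) t)))
    (strict_words N (Suc (N + j)))"
proof (induction j)
  case 0
  have "zs = []" if "zs \<in> strict_words N (Suc N)" for zs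
    using that by (cases zs) (auto simp: strict_words_def)
  then have "strict_words N (Suc N) = {[]}"
    by (auto simp: strict_words_def)
  then show ?case
    using assms shifted_prod_pos[of t N] shifted_prod_pos[of "t - u" N]
    by (simp add: has_sum_finite_iff)
next
  case (Suc j)
  let ?M = "Suc (N + j)"
  let ?V = "shifted_prod (N + j) (t - u) / shifted_prod N (t - u) * (shifted_prod N t / shifted_prod (N + j) t)"
  let ?app = "\<lambda>(zs, k). zs @ [(?M, k)]"
  \<comment> \<open>In a strictly increasing word \<open>?M\<close> occurs at most once, and then in
    the last position.\<close>
  have split: "strict_words N (Suc ?M) = strict_words N ?M \<union> ?app ` (strict_words N ?M \<times> {0<..})" (is "?L = ?R")
  proof
    show "?R \<subseteq> ?L"
      by (fastforce simp: strict_words_def sorted_wrt_append)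
    show "?L \<subseteq> ?R"
    proof
      fix zs assume zs: "zs \<in> ?L"
      show "zs \<in> ?R"
      proof (cases "\<forall>x\<in>set zs. fst x < ?M")
        case True
        then show ?thesis using zs by (auto simp: strict_words_def)
      next
        case False
        then obtain b k where bk: "(b, k) \<in> set zs" "\<not> b < ?M" by auto
        with zs have b: "b = ?M" by (auto simp: strict_words_def)
        have "zs \<noteq> []" using bk by auto
        then obtain ys c l where ys: "zs = ys @ [(c, l)]"
          by (metis append_butlast_last_id surj_pair)
        have "c = ?M" using zs bk(1) by (auto simp: strict_words_def ys sorted_wrt_append b)
        then have "ys \<in> strict_words N ?M" "0 < l"
          using zs by (auto simp: strict_words_def ys sorted_wrt_append)
        then show ?thesis using \<open>c = ?M\<close> ys by auto
      qed
    qed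
  qed
  have "((\<lambda>(zs, k). word_weight u t zs * (u * t ^ (k - 1) / real ?M ^ k)) has_sum
      (?V * (u / (real ?M - t)))) (strict_words N ?M \<times> {0<..})"
    using assms by (intro has_sum_product_nonneg Suc.IH has_sum_letter) (auto intro: word_weight_nonneg)
  then have "(word_weight u t has_sum (?V * (u / (real ?M - t)))) (?app ` (strict_words N ?M \<times> {0<..}))"
    by (subst has_sum_reindex) (auto simp: inj_on_def o_def case_prod_unfold word_weight_def)
  moreover have "strict_words N ?M \<inter> ?app ` (strict_words N ?M \<times> {0<..}) = {}"
    by (auto simp: strict_words_def)
  ultimately have "(word_weight u t has_sum (?V + ?V * (u / (real ?M - t)))) (strict_words N (Suc ?M))"
    unfolding split by (intro has_sum_Un_disjoint Suc.IH)
  moreover have "v + v * (u / (real ?M - t)) = v * ((real ?M - (t - u)) / (real ?M - t))" for v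
  proof -
    have "real ?M - t \<noteq> 0" using assms by simp
    then show ?thesis by (simp add: divide_simps del: of_nat_Suc) (simp add: algebra_simps)
  qed
  ultimately have "(word_weight u t has_sum (?V * ((real ?M - (t - u)) / (real ?M - t)))) (strict_words N (Suc ?M))"
    by (simp only:)
  then show ?case
    by (simp add: shifted_prod_Suc mult_ac)
qed

text \<open>Lists of length n contribute \<open>T ^ n\<close>, so the total is a geometric
  series.\<close>

lemma has_sum_lists:
  fixes f :: "'a \<Rightarrow> real"
  assumes "(f has_sum T) A" "\<And>x. x \<in> A \<Longrightarrow> 0 \<le> f x" "T < 1"
  shows "((\<lambda>xs. \<Prod>x\<leftarrow>xs. f x) has_sum (1 / (1 - T))) (lists A)"
proof -
  have T: "0 \<le> T" using assms by (auto intro: has_sum_nonneg)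
  have nonneg: "0 \<le> (\<Prod>x\<leftarrow>xs. f x)" if "xs \<in> lists A" for xs
    using that assms(2) by (intro prod_list_nonneg) auto
  have len: "((\<lambda>xs. \<Prod>x\<leftarrow>xs. f x) has_sum T ^ n) {xs \<in> lists A. length xs = n}" for n
  proof (induction n)
    case 0
    have "{xs \<in> lists A. length xs = 0} = {[]}" by auto
    then show ?case by (simp add: has_sum_finite_iff)
  next
    case (Suc n)
    have "((\<lambda>(x, xs). f x * (\<Prod>x\<leftarrow>xs. f x)) has_sum (T * T ^ n)) (A \<times> {xs \<in> lists A. length xs = n})"
      using assms nonneg Suc by (intro has_sum_product_nonneg) auto
    then show ?case
      by (subst (asm) has_sum_reindex_bij_witness[of _ "\<lambda>xs. (hd xs, tl xs)" "\<lambda>(x, xs). x # xs"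
            "{xs \<in> lists A. length xs = Suc n}" "\<lambda>xs. \<Prod>x\<leftarrow>xs. f x"])
        (auto simp: length_Suc_conv)
  qed
  have "((\<lambda>(n, xs). \<Prod>x\<leftarrow>xs. f x) has_sum (1 / (1 - T))) (SIGMA n:UNIV. {xs \<in> lists A. length xs = n})"
    using T assms(3) len nonneg
    by (intro has_sum_Sigma_nonneg[where g = "\<lambda>n. T ^ n"] sums_nonneg_imp_has_sum geometric_sums) auto
  then show ?thesis
    by (subst has_sum_reindex_bij_witness[of _ snd "\<lambda>xs. (length xs, xs)"
          "SIGMA n:UNIV. {xs \<in> lists A. length xs = n}" "\<lambda>(n, xs). \<Prod>x\<leftarrow>xs. f x"]) auto
qed

text \<open>Each integer b with 0 < b <= m may carry any number of letters, so it contributes 1/(1 -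
  u/(b - t)) = (b - t)/(b - (t + u)).\<close>

lemma has_sum_weak_words:
  fixes u t :: real
  assumes "0 \<le> u" "0 \<le> t" "t + u < 1"
  shows "((word_weight u t) has_sum (shifted_prod m t / shifted_prod m (t + u))) (weak_words m)"
proof (induction m)
  case 0
  have "zs = []" if "zs \<in> weak_words 0" for zs
    using that by (cases zs) (auto simp: weak_words_def)
  then have "weak_words 0 = {[]}"
    by (auto simp: weak_words_def)
  then show ?case by (simp add: has_sum_finite_iff)
next
  case (Suc m)
  let ?A = "{(b, k). b = Suc m \<and> 0 < k} :: (nat \<times> nat) set"
  let ?f = "\<lambda>(a, k). u * t ^ (k - 1) / real a ^ k"
  have "((\<lambda>k. u * t ^ (k - 1) / real (Suc m) ^ k) has_sum (u / (real (Suc m) - t))) {0<..}"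
    using assms by (intro has_sum_letter) auto
  then have "(?f has_sum (u / (real (Suc m) - t))) ?A"
    by (subst has_sum_reindex_bij_witness[of _ "Pair (Suc m)" snd "{0<..}"
          "\<lambda>k. u * t ^ (k - 1) / real (Suc m) ^ k"]) auto
  moreover have "u / (real (Suc m) - t) < 1" using assms by (simp add: divide_simps)
  ultimately have lst: "(word_weight u t has_sum (1 / (1 - u / (real (Suc m) - t)))) (lists ?A)"
    unfolding word_weight_def using assms by (intro has_sum_lists) auto
  have "((\<lambda>(xs, ys). word_weight u t xs * word_weight u t ys) has_sum
      (shifted_prod m t / shifted_prod m (t + u) * (1 / (1 - u / (real (Suc m) - t))))) (weak_words m \<times> lists ?A)"
    using assms by (intro has_sum_product_nonneg Suc lst) (auto intro: word_weight_nonneg)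
  moreover have "((\<lambda>(xs, ys). word_weight u t xs * word_weight u t ys) has_sum T) (weak_words m \<times> lists ?A)
      \<longleftrightarrow> (word_weight u t has_sum T) (weak_words (Suc m))" for T
  \<comment> \<open>A weakly increasing word is cut in front of its first entry above
    \<open>m\<close>; the tail is an arbitrary list of letters at \<open>Suc m\<close>.\<close>
  proof (rule has_sum_reindex_bij_witness[of _ "\<lambda>zs. (takeWhile (\<lambda>x. fst x \<le> m) zs, dropWhile (\<lambda>x. fst x \<le> m) zs)"
        "\<lambda>(xs, ys). xs @ ys"])
    fix p assume "p \<in> weak_words m \<times> lists ?A"
    then obtain xs ys where p: "p = (xs, ys)" "xs \<in> weak_words m" "ys \<in> lists ?A" by auto
    have xs: "fst x \<le> m" if "x \<in> set xs" for x using p(2) that by (auto simp: weak_words_def)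
    have ys: "fst x = Suc m" if "x \<in> set ys" for x using p(3) that by auto
    have "takeWhile (\<lambda>x. fst x \<le> m) ys = []" "dropWhile (\<lambda>x. fst x \<le> m) ys = ys"
      using ys by (cases ys; force)+
    then show "(takeWhile (\<lambda>x. fst x \<le> m) (case p of (xs, ys) \<Rightarrow> xs @ ys), dropWhile (\<lambda>x. fst x \<le> m) (case p of (xs, ys) \<Rightarrow> xs @ ys)) = p"
      using xs by (simp add: p takeWhile_append2 dropWhile_append2)
    have "sorted_wrt (\<le>) (map fst ys)"
      using ys by (auto simp: sorted_wrt_map sorted_wrt_iff_nth_less)
    then show "(case p of (xs, ys) \<Rightarrow> xs @ ys) \<in> weak_words (Suc m)"
      using p(2,3) xs ys by (force simp: p weak_words_def sorted_wrt_append)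
    show "word_weight u t (case p of (xs, ys) \<Rightarrow> xs @ ys) = (case p of (xs, ys) \<Rightarrow> word_weight u t xs * word_weight u t ys)"
      by (simp add: p)
  next
    fix zs assume zs: "zs \<in> weak_words (Suc m)"
    show "(case (takeWhile (\<lambda>x. fst x \<le> m) zs, dropWhile (\<lambda>x. fst x \<le> m) zs) of (xs, ys) \<Rightarrow> xs @ ys) = zs" by simp
    have "sorted_wrt (\<le>) (map fst (takeWhile (\<lambda>x. fst x \<le> m) zs) @ map fst (dropWhile (\<lambda>x. fst x \<le> m) zs))"
      using zs by (simp add: weak_words_def flip: map_append)
    then have srt: "sorted_wrt (\<le>) (map fst (takeWhile (\<lambda>x. fst x \<le> m) zs))"
      "sorted_wrt (\<le>) (map fst (dropWhile (\<lambda>x. fst x \<le> m) zs))"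
      unfolding sorted_wrt_append by auto
    have "(b, k) \<in> ?A" if "(b, k) \<in> set (dropWhile (\<lambda>x. fst x \<le> m) zs)" for b k
    proof -
      let ?ys = "dropWhile (\<lambda>x. fst x \<le> m) zs"
      have "?ys \<noteq> []" using that by (metis empty_iff empty_set)
      then have h: "\<not> fst (hd ?ys) \<le> m" by (rule hd_dropWhile)
      have "fst (hd ?ys) \<le> b" using that srt(2) by (cases ?ys) auto
      moreover have "(b, k) \<in> set zs" using that by (rule set_dropWhileD)
      ultimately show ?thesis using zs h by (auto simp: weak_words_def)
    qed
    moreover have "takeWhile (\<lambda>x. fst x \<le> m) zs \<in> weak_words m"
      using zs srt by (auto simp: weak_words_def sorted_wrt_append dest: set_takeWhileD)
    ultimately show "(takeWhile (\<lambda>x. fst x \<le> m) zs, dropWhile (\<lambda>x. fst x \<le> m) zs) \<in> weak_words m \<times> lists ?A"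
      by (auto simp only: mem_Sigma_iff in_lists_conv_set)
  qed simp
  moreover have "shifted_prod m t / shifted_prod m (t + u) * (1 / (1 - u / (real (Suc m) - t))) =
      shifted_prod (Suc m) t / shifted_prod (Suc m) (t + u)"
  proof -
    have "1 / (1 - u / (real (Suc m) - t)) = (real (Suc m) - t) / (real (Suc m) - (t + u))"
      using assms by (simp add: field_simps)
    then show ?thesis by (simp add: shifted_prod_Suc)
  qed
  ultimately show ?case by simp
qed

section \<open>From words to chains and blocks\<close>

lemma recip_prod_Nil [simp]: "recip_prod [] m = 1"
  by (simp add: recip_prod_def)

lemma recip_prod_Cons [simp]: "recip_prod (x # k) (y # m) = 1 / real y ^ x * recip_prod k m"
  by (simp add: recip_prod_def prod.lessThan_Suc_shift del: prod.lessThan_Suc)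

lemma recip_prod_nonneg: "0 \<le> recip_prod k m"
  by (auto simp: recip_prod_def intro!: prod_nonneg)

lemma recip_prod_append:
  "length k = length m \<Longrightarrow> recip_prod (k @ k') (m @ m') = recip_prod k m * recip_prod k' m'"
  by (induction k m rule: list_induct2) simp_all

lemma is_index_length_le: "is_index k \<Longrightarrow> length k \<le> sum_list k"
  by (induction k) (auto simp: is_index_def Suc_le_eq)

lemma admissible_length_le:
  assumes "admissible k" "k \<noteq> []"
  shows "length k + 1 \<le> sum_list k"
proof -
  obtain xs x where k: "k = xs @ [x]" using assms(2) by (metis append_butlast_last_id)
  then show ?thesis
    using assms is_index_length_le[of xs] by (auto simp: admissible_def is_index_def)
qed

lemma word_weight_eq:
  assumes "\<forall>x\<in>set zs. 0 < snd x"
  shows "word_weight u t zs =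
    recip_prod (map snd zs) (map fst zs) * u ^ length zs * t ^ (sum_list (map snd zs) - length zs)"
  using assms
proof (induction zs)
  case (Cons z zs)
  obtain a k where z: "z = (a, k)" by fastforce
  have "length zs \<le> sum_list (map snd zs)"
    using is_index_length_le[of "map snd zs"] Cons.prems by (auto simp: is_index_def)
  then have "k + sum_list (map snd zs) - Suc (length zs) = (k - 1) + (sum_list (map snd zs) - length zs)"
    using Cons.prems z by simp
  then have "t ^ (k + sum_list (map snd zs) - Suc (length zs)) = t ^ (k - 1) * t ^ (sum_list (map snd zs) - length zs)"
    by (simp only: power_add)
  moreover have "word_weight u t (z # zs) = u * t ^ (k - 1) / real a ^ k * word_weight u t zs"
    by (simp add: word_weight_def z)
  ultimately show ?case
    using Cons by (simp add: z mult_ac)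
qed simp

definition chain_pairs :: "nat \<Rightarrow> nat \<Rightarrow> (nat list \<times> nat list) set"
  where "chain_pairs N m = {(k, a). k \<noteq> [] \<and> admissible k \<and> length a = length k \<and> sorted_wrt (<) a \<and>
    (\<forall>x\<in>set a. N < x) \<and> last a = m}"

text \<open>The bound \<open>N\<close> concerns the strict chain only. This fits the linking
  condition for s2 = 0, where \<open>a1\<close> has to lie above N = \<open>last a2\<close> while
  \<open>b1\<close> may still start at 1.\<close>

definition blocks :: "nat \<Rightarrow> (nat list \<times> nat list \<times> nat list \<times> nat list) set"
  where "blocks N = {(k, l, a, b). k \<noteq> [] \<and> admissible k \<and> is_index l \<and> length a = length k \<and>
    length b = length l + 1 \<and> sorted_wrt (<) a \<and> sorted_wrt (\<le>) b \<and> (\<forall>x\<in>set a. N < x) \<and>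
    (\<forall>x\<in>set b. 0 < x) \<and> last b = last a}"

text \<open>The last letter sits at m, has exponent at least 2 and is not marked by y; it
  contributes 1/(m (m - t)). What precedes it is an arbitrary strict word between N and m.\<close>

lemma has_sum_chains:
  fixes y t :: real
  assumes "0 \<le> y" "0 \<le> t" "t < 1" "N < m"
  shows "((\<lambda>(k, a). recip_prod k a * y ^ (length k - 1) * t ^ (sum_list k - length k - 1)) has_sum
    (shifted_prod (m - 1) (t - y) / shifted_prod N (t - y) * (shifted_prod N t / (real m * shifted_prod m t))))
    (chain_pairs N m)"
proof -
  obtain j where m: "m = Suc (N + j)" using assms(4) less_iff_Suc_add by auto
  have "((\<lambda>k. 1 / real m * t ^ (k - 1) / real m ^ k) has_sum (1 / real m / (real m - t))) {0<..}"
    using assms by (intro has_sum_letter) auto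
  then have last: "((\<lambda>k. t ^ (k - 2) / real m ^ k) has_sum (1 / (real m * (real m - t)))) {2..}"
    by (subst (asm) has_sum_reindex_bij_witness[of _ "\<lambda>k. k - 1" Suc "{2..}" "\<lambda>k. t ^ (k - 2) / real m ^ k"]) auto
  let ?V = "shifted_prod (m - 1) (t - y) / shifted_prod N (t - y) * (shifted_prod N t / shifted_prod (m - 1) t)"
  have "(word_weight y t has_sum ?V) (strict_words N m)"
    using has_sum_strict_words[OF assms(1-3), of N j] by (simp add: m)
  then have "((\<lambda>(zs, k). word_weight y t zs * (t ^ (k - 2) / real m ^ k)) has_sum (?V * (1 / (real m * (real m - t)))))
      (strict_words N m \<times> {2::nat..})"
    using last assms by (intro has_sum_product_nonneg) (auto intro: word_weight_nonneg)
  moreover have "?V * (1 / (real m * (real m - t))) =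
      shifted_prod (m - 1) (t - y) / shifted_prod N (t - y) * (shifted_prod N t / (real m * shifted_prod m t))"
    by (simp add: m shifted_prod_Suc mult_ac del: of_nat_Suc)
  moreover have "((\<lambda>(zs, k). word_weight y t zs * (t ^ (k - 2) / real m ^ k)) has_sum T) (strict_words N m \<times> {2::nat..}) \<longleftrightarrow>
      ((\<lambda>(k, a). recip_prod k a * y ^ (length k - 1) * t ^ (sum_list k - length k - 1)) has_sum T) (chain_pairs N m)" for T
  proof (rule has_sum_reindex_bij_witness[of _ "\<lambda>(k, a). (zip (butlast a) (butlast k), last k)"
        "\<lambda>(zs, k). (map snd zs @ [k], map fst zs @ [m])"])
    fix p assume "p \<in> strict_words N m \<times> {2::nat..}"
    then obtain zs k where p: "p = (zs, k)" "zs \<in> strict_words N m" "2 \<le> k" by auto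
    have zs: "\<forall>x\<in>set zs. 0 < snd x" using p(2) by (auto simp: strict_words_def)
    show "(case (case p of (zs, k) \<Rightarrow> (map snd zs @ [k], map fst zs @ [m])) of
          (k, a) \<Rightarrow> (zip (butlast a) (butlast k), last k)) = p"
      by (simp add: p zip_map_fst_snd)
    show "(case p of (zs, k) \<Rightarrow> (map snd zs @ [k], map fst zs @ [m])) \<in> chain_pairs N m"
      using p assms by (fastforce simp: chain_pairs_def strict_words_def sorted_wrt_append admissible_def is_index_def)
    have "length zs \<le> sum_list (map snd zs)"
      using is_index_length_le[of "map snd zs"] zs by (auto simp: is_index_def)
    then have "sum_list (map snd zs) + k - Suc (Suc (length zs)) = (sum_list (map snd zs) - length zs) + (k - 2)"
      using p by simp
    then have "t ^ (sum_list (map snd zs) + k - Suc (Suc (length zs))) = t ^ (sum_list (map snd zs) - length zs) * t ^ (k - 2)"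
      by (simp only: power_add)
    then show "(case (case p of (zs, k) \<Rightarrow> (map snd zs @ [k], map fst zs @ [m])) of
          (k, a) \<Rightarrow> recip_prod k a * y ^ (length k - 1) * t ^ (sum_list k - length k - 1)) =
        (case p of (zs, k) \<Rightarrow> word_weight y t zs * (t ^ (k - 2) / real m ^ k))"
      using zs by (simp add: p word_weight_eq recip_prod_append mult_ac)
  next
    fix p assume "p \<in> chain_pairs N m"
    then obtain k a where p: "p = (k, a)" "(k, a) \<in> chain_pairs N m" by (cases p) auto
    then have ne: "k \<noteq> []" "a \<noteq> []" "length k = length a" by (auto simp: chain_pairs_def)
    obtain k' \<kappa> where k: "k = k' @ [\<kappa>]" using ne(1) by (metis append_butlast_last_id)
    obtain a' c where a: "a = a' @ [c]" using ne(2) by (metis append_butlast_last_id)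
    have c: "c = m" using p by (simp add: a chain_pairs_def)
    have len: "length a' = length k'" using ne by (simp add: a k)
    show "(case (case p of (k, a) \<Rightarrow> (zip (butlast a) (butlast k), last k)) of
        (zs, k) \<Rightarrow> (map snd zs @ [k], map fst zs @ [m])) = p"
      using len by (simp add: p a k c)
    show "(case p of (k, a) \<Rightarrow> (zip (butlast a) (butlast k), last k)) \<in> strict_words N m \<times> {2::nat..}"
      using len p by (auto simp: a k chain_pairs_def strict_words_def sorted_wrt_append admissible_def is_index_def
        dest: set_zip_leftD set_zip_rightD)
  qed simp
  ultimately show ?thesis by (simp only:)
qed

text \<open>Here \<open>x\<close> marks the depth of \<open>l\<close>, \<open>y\<close> the depth of \<open>k\<close> minus one, and \<open>t\<close> the excess of the total weight over
  its least possible value.\<close>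

lemma has_sum_blocks:
  fixes x y t :: real
  assumes "0 \<le> x" "0 \<le> y" "0 \<le> t" "t + x < 1"
    and "((\<lambda>m. shifted_prod (m - 1) (t - y) / (real m * shifted_prod m (t + x))) has_sum V) {N<..}"
  shows "((\<lambda>(k, l, a, b). recip_prod k a * recip_prod l b * t ^ (sum_list k + sum_list l - length k - length l - 1) *
      y ^ (length k - 1) * x ^ length l) has_sum (shifted_prod N t / shifted_prod N (t - y) * V)) (blocks N)"
proof -
  let ?f = "\<lambda>(k, a). recip_prod k a * y ^ (length k - 1) * t ^ (sum_list k - length k - 1)"
  let ?F = "\<lambda>(k, l, a, b). recip_prod k a * recip_prod l b * t ^ (sum_list k + sum_list l - length k - length l - 1) *
      y ^ (length k - 1) * x ^ length l"
  let ?G = "\<lambda>(m, c, ys). ?f c * word_weight x t ys"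
  let ?i = "\<lambda>(k, l, a, b). (last a, (k, a), zip (butlast b) l)"
  let ?j = "\<lambda>(m, (k, a), ys). (k, map snd ys, a, map fst ys @ [m])"
  have t: "t < 1" using assms by linarith
  have "((\<lambda>(c, ys). ?f c * word_weight x t ys) has_sum
      (shifted_prod N t / shifted_prod N (t - y) * (shifted_prod (m - 1) (t - y) / (real m * shifted_prod m (t + x)))))
      (chain_pairs N m \<times> weak_words m)" if m: "m \<in> {N<..}" for m
  proof -
    have "((\<lambda>(c, ys). ?f c * word_weight x t ys) has_sum
      (shifted_prod (m - 1) (t - y) / shifted_prod N (t - y) * (shifted_prod N t / (real m * shifted_prod m t)) *
       (shifted_prod m t / shifted_prod m (t + x)))) (chain_pairs N m \<times> weak_words m)"
      using assms m t
      by (intro has_sum_product_nonneg has_sum_weak_words has_sum_chains)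
        (auto intro!: word_weight_nonneg mult_nonneg_nonneg recip_prod_nonneg)
    \<comment> \<open>The factor \<open>shifted_prod m t\<close> is a denominator for the strict
      chain and a numerator for the weak one. After its cancellation the sum over m is the one in
      \<open>shifted_prod_transformation\<close>, with t - y and t + x as parameters.\<close>
    moreover have "shifted_prod m t \<noteq> 0" using shifted_prod_pos[OF t, of m] by simp
    ultimately show ?thesis by (simp add: mult_ac)
  qed
  then have "(?G has_sum (shifted_prod N t / shifted_prod N (t - y) * V)) (SIGMA m:{N<..}. chain_pairs N m \<times> weak_words m)"
    using assms
    by (intro has_sum_Sigma_nonneg[OF _ has_sum_cmult_right[OF assms(5)]])
      (auto intro!: word_weight_nonneg mult_nonneg_nonneg recip_prod_nonneg simp: case_prod_unfold)
  moreover have "(?G has_sum T) (SIGMA m:{N<..}. chain_pairs N m \<times> weak_words m) \<longleftrightarrow> (?F has_sum T) (blocks N)" for T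
  proof (rule has_sum_reindex_bij_witness[of _ ?i
        ?j])
    fix p assume "p \<in> (SIGMA m:{N<..}. chain_pairs N m \<times> weak_words m)"
    then obtain m k a ys where p: "p = (m, (k, a), ys)" "N < m" "(k, a) \<in> chain_pairs N m" "ys \<in> weak_words m" by auto
    have ys: "\<forall>x\<in>set ys. 0 < snd x" using p(4) by (auto simp: weak_words_def)
    have last: "last a = m" using p(3) by (simp add: chain_pairs_def)
    show "?i (?j p) = p"
      by (simp add: p zip_map_fst_snd last)
    show "?j p \<in> blocks N"
      using p by (fastforce simp: chain_pairs_def blocks_def weak_words_def sorted_wrt_append is_index_def)
    have "length ys \<le> sum_list (map snd ys)"
      using is_index_length_le[of "map snd ys"] ys by (auto simp: is_index_def)
    moreover have "length k + 1 \<le> sum_list k"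
      using p(3) by (intro admissible_length_le) (auto simp: chain_pairs_def)
    ultimately have "sum_list k + sum_list (map snd ys) - length k - length ys - 1 =
        (sum_list k - length k - 1) + (sum_list (map snd ys) - length ys)"
      by linarith
    then have "t ^ (sum_list k + sum_list (map snd ys) - length k - length ys - 1) =
        t ^ (sum_list k - length k - 1) * t ^ (sum_list (map snd ys) - length ys)"
      by (simp only: power_add)
    moreover have "recip_prod (map snd ys) (map fst ys @ [m]) = recip_prod (map snd ys) (map fst ys)"
      using recip_prod_append[of "map snd ys" "map fst ys" "[]" "[m]"] by simp
    ultimately show "?F (?j p) = ?G p"
      using ys by (simp add: p word_weight_eq mult_ac)
  next
    fix p assume "p \<in> blocks N"
    then obtain k l a b where p: "p = (k, l, a, b)" "(k, l, a, b) \<in> blocks N" by (cases p) auto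
    then have b0: "b \<noteq> []" by (auto simp: blocks_def)
    obtain b' c where b: "b = b' @ [c]" using b0 by (metis append_butlast_last_id)
    have c: "c = last a" and len: "length b' = length l" using p by (simp_all add: b blocks_def)
    have "a \<noteq> []" using p by (auto simp: blocks_def)
    then have a: "last a \<in> set a" by simp
    show "?j (?i p) = p"
      using len by (simp add: p b c)
    show "?i p \<in> (SIGMA m:{N<..}. chain_pairs N m \<times> weak_words m)"
      using len p a by (auto simp: b c blocks_def chain_pairs_def weak_words_def sorted_wrt_append is_index_def
        dest: set_zip_leftD set_zip_rightD)
  qed simp
  ultimately show ?thesis by simp
qed

text \<open>One variable at a time, in the order \<open>x\<close>, \<open>y\<close>,
  \<open>y'\<close>, \<open>t\<close>: each comparison of coefficients leaves a common sum for the
  remaining variables.\<close>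

lemma has_sum_coefficients_eq4:
  fixes f :: "'a \<Rightarrow> real" and g :: "'b \<Rightarrow> real"
  assumes "0 < \<epsilon>"
    and ex: "\<And>x y y' t. 0 < x \<Longrightarrow> x < \<epsilon> \<Longrightarrow> 0 < y \<Longrightarrow> y < \<epsilon> \<Longrightarrow> 0 < y' \<Longrightarrow> y' < \<epsilon> \<Longrightarrow> 0 < t \<Longrightarrow> t < \<epsilon> \<Longrightarrow>
      \<exists>T. ((\<lambda>z. f z * t ^ dt z * y' ^ dy' z * y ^ dy z * x ^ dx z) has_sum T) D \<and>
          ((\<lambda>z. g z * t ^ et z * y' ^ ey' z * y ^ ey z * x ^ ex z) has_sum T) E"
  shows "\<exists>T. (f has_sum T) {z\<in>D. dx z = i \<and> dy z = j \<and> dy' z = j' \<and> dt z = k} \<and>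
             (g has_sum T) {z\<in>E. ex z = i \<and> ey z = j \<and> ey' z = j' \<and> et z = k}"
proof -
  have h1: "\<exists>T. ((\<lambda>z. f z * t ^ dt z * y' ^ dy' z * y ^ dy z) has_sum T) {z\<in>D. dx z = i} \<and>
            ((\<lambda>z. g z * t ^ et z * y' ^ ey' z * y ^ ey z) has_sum T) {z\<in>E. ex z = i}"
    if "0 < y" "y < \<epsilon>" "0 < y'" "y' < \<epsilon>" "0 < t" "t < \<epsilon>" for y y' t
    by (rule has_sum_coefficients_eq[OF assms(1)]) (rule ex[OF _ _ that])
  have h2: "\<exists>T. ((\<lambda>z. f z * t ^ dt z * y' ^ dy' z) has_sum T) {z\<in>{z\<in>D. dx z = i}. dy z = j} \<and>
            ((\<lambda>z. g z * t ^ et z * y' ^ ey' z) has_sum T) {z\<in>{z\<in>E. ex z = i}. ey z = j}"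
    if "0 < y'" "y' < \<epsilon>" "0 < t" "t < \<epsilon>" for y' t
    by (rule has_sum_coefficients_eq[OF assms(1)]) (rule h1[OF _ _ that])
  have h3: "\<exists>T. ((\<lambda>z. f z * t ^ dt z) has_sum T) {z\<in>{z\<in>{z\<in>D. dx z = i}. dy z = j}. dy' z = j'} \<and>
            ((\<lambda>z. g z * t ^ et z) has_sum T) {z\<in>{z\<in>{z\<in>E. ex z = i}. ey z = j}. ey' z = j'}"
    if "0 < t" "t < \<epsilon>" for t
    by (rule has_sum_coefficients_eq[OF assms(1)]) (rule h2[OF _ _ that])
  have "\<exists>T. (f has_sum T) {z\<in>{z\<in>{z\<in>{z\<in>D. dx z = i}. dy z = j}. dy' z = j'}. dt z = k} \<and>
            (g has_sum T) {z\<in>{z\<in>{z\<in>{z\<in>E. ex z = i}. ey z = j}. ey' z = j'}. et z = k}"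
    by (rule has_sum_coefficients_eq[OF assms(1)]) (rule h3)
  then show ?thesis by simp
qed

text \<open>The coefficient of y^\<rho> t^e x^s in 1/((n - (x + y)) (n - (t + x))).\<close>

definition simple_coeff :: "nat \<Rightarrow> nat \<times> nat \<times> nat \<Rightarrow> real"
  where "simple_coeff n = (\<lambda>(\<rho>, e, s). real ((s + (\<rho> + e + 1)) choose s) / real n ^ (s + \<rho> + e + 2))"

lemma simple_coeff_nonneg: "0 \<le> simple_coeff n p"
  by (auto simp: simple_coeff_def split: prod.split)

lemma has_sum_simple_coeff:
  fixes x y t :: real
  assumes "0 \<le> x" "0 \<le> y" "0 \<le> t" "x + y < 1" "x + t < 1" "1 \<le> n"
  shows "((\<lambda>(\<rho>, e, s). simple_coeff n (\<rho>, e, s) * t ^ e * y ^ \<rho> * x ^ s) has_sum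
    (1 / ((real n - (x + y)) * (real n - (t + x))))) UNIV"
proof -
  have le: "u / real n \<le> u" if "0 \<le> u" for u :: real
    using that assms(6) mult_left_mono[of 1 "real n" u] by (simp add: divide_le_eq)
  have "x / real n + y / real n \<le> x + y" "x / real n + t / real n \<le> x + t"
    using assms le by (auto intro!: add_mono)
  then have "((\<lambda>(\<rho>, e, s). real ((s + (\<rho> + e + 1)) choose s) * (x / n) ^ s * (y / n) ^ \<rho> * (t / n) ^ e)
    has_sum (1 / ((1 - (x / n + y / n)) * (1 - (x / n + t / n))))) UNIV"
    using assms by (intro has_sum_binomial_series) auto
  then have "((\<lambda>p. 1 / real n ^ 2 * (\<lambda>(\<rho>, e, s). real ((s + (\<rho> + e + 1)) choose s) * (x / n) ^ s * (y / n) ^ \<rho> * (t / n) ^ e) p)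
    has_sum (1 / real n ^ 2 * (1 / ((1 - (x / n + y / n)) * (1 - (x / n + t / n)))))) UNIV"
    by (rule has_sum_cmult_right)
  moreover have "1 / real n ^ 2 * (1 / ((1 - (x / n + y / n)) * (1 - (x / n + t / n)))) =
      1 / ((real n - (x + y)) * (real n - (t + x)))"
  proof -
    have "1 - (x / n + y / n) = (real n - (x + y)) / n" "1 - (x / n + t / n) = (real n - (t + x)) / n"
      using assms(6) by (simp_all add: field_simps)
    then show ?thesis using assms(6) by (simp add: power2_eq_square)
  qed
  moreover have "1 / real n ^ 2 * (\<lambda>(\<rho>, e, s). real ((s + (\<rho> + e + 1)) choose s) * (x / n) ^ s * (y / n) ^ \<rho> * (t / n) ^ e) p =
     (\<lambda>(\<rho>, e, s). simple_coeff n (\<rho>, e, s) * t ^ e * y ^ \<rho> * x ^ s) p" for p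
    by (cases p) (simp add: simple_coeff_def power_divide power_add power2_eq_square mult_ac)
  ultimately show ?thesis by (simp only:)
qed

definition block_val :: "nat list \<times> nat list \<times> nat list \<times> nat list \<Rightarrow> real"
  where "block_val = (\<lambda>(k, l, a, b). recip_prod k a * recip_prod l b)"

definition block_set :: "nat \<Rightarrow> nat \<Rightarrow> nat \<Rightarrow> (nat list \<times> nat list \<times> nat list \<times> nat list) set"
  where "block_set s r w = {(k, l, a, b) \<in> blocks 0. length k = r \<and> length l = s \<and> sum_list k + sum_list l = w}"

lemma block_val_nonneg: "0 \<le> block_val z"
  by (auto simp: block_val_def recip_prod_nonneg split: prod.split)

lemma blocks_weight_ge:
  assumes "(k, l, a, b) \<in> blocks N"
  shows "length k + length l + 1 \<le> sum_list k + sum_list l"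
  using admissible_length_le[of k] is_index_length_le[of l] assms by (auto simp: blocks_def)

lemma block_set_empty: "w < s + r + 1 \<Longrightarrow> block_set s r w = {}"
  using blocks_weight_ge by (fastforce simp: block_set_def)

lemma has_sum_inverse_power:
  assumes "2 \<le> w"
  shows "((\<lambda>n. 1 / real n ^ w) has_sum mzv [w]) {1..}"
proof -
  have "(\<lambda>n. 1 / real n ^ w) summable_on UNIV"
    using inverse_power_summable[of w, where 'a = real] assms
    by (intro summable_nonneg_imp_summable_on) (auto simp: field_simps)
  from summable_on_subset_banach[OF this, of "{1..}"]
  have "((\<lambda>n. 1 / real n ^ w) has_sum (\<Sum>\<^sub>\<infinity>n\<in>{1..}. 1 / real n ^ w)) {1..}"
    by (intro has_sum_infsum) simp
  moreover have "(\<Sum>\<^sub>\<infinity>n\<in>{1..}. 1 / real n ^ w) = mzv [w]"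
    unfolding mzv_def
    by (rule infsum_reindex_bij_witness[of _ hd "\<lambda>n. [n]"]) (auto simp: length_Suc_conv)
  ultimately show ?thesis by simp
qed

text \<open>The connected sum with N = 0 turns the generating function into the sum over n of 1/((n
  - (x + y)) (n - (t + x))). In its coefficients \<rho> = r - 1 and e = w - s - r - 1 enter only
  through their sum, so r disappears from the result. For s = 0 this is the sum formula for multiple
  zeta values.\<close>

lemma has_sum_block_set:
  assumes "0 < r" "s + r + 1 \<le> w"
  shows "(block_val has_sum (real ((w - 1) choose s) * mzv [w])) (block_set s r w)"
proof -
  let ?dx = "\<lambda>(k, l, a, b). length l" and ?dy = "\<lambda>(k, l, a, b). length k - 1"
    and ?dt = "\<lambda>(k, l, a, b). sum_list k + sum_list l - length k - length l - 1"
    and ?D = "blocks 0"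
  let ?g = "\<lambda>(n, p). simple_coeff n p"
    and ?ex = "\<lambda>(n, \<rho>, e, s). s" and ?ey = "\<lambda>(n, \<rho>, e, s). \<rho>" and ?et = "\<lambda>(n, \<rho>, e, s). e"
    and ?E = "{1..} \<times> UNIV"
  \<comment> \<open>Three markers suffice here; the fourth variable \<open>y'\<close> receives the
    exponent 0 throughout.\<close>
  have "\<exists>T. ((\<lambda>z. block_val z * t ^ ?dt z * y' ^ 0 * y ^ ?dy z * x ^ ?dx z) has_sum T) ?D \<and>
      ((\<lambda>z. ?g z * t ^ ?et z * y' ^ 0 * y ^ ?ey z * x ^ ?ex z) has_sum T) ?E"
    if "0 < x" "x < 1 / 2" "0 < y" "y < 1 / 2" "0 < y'" "y' < 1 / 2" "0 < t" "t < 1 / 2" for x y y' t :: real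
  proof -
    have "t - y < 1" "t + x < 1" "t + x - (t - y) < 1" using that by simp_all
    from shifted_prod_transformation[OF this, of 0]
    obtain V where V: "((\<lambda>n. shifted_prod 0 (t - y) * shifted_prod n (t + x) /
                   (shifted_prod (0 + n) (t + x) * ((real n - (t + x - (t - y))) * (real n - (t + x))))) has_sum V) {1..}"
             "((\<lambda>m. shifted_prod (m - 1) (t - y) / (real m * shifted_prod m (t + x))) has_sum V) {0<..}"
      by blast
    have tx: "shifted_prod n (t + x) \<noteq> 0" for n
      using shifted_prod_pos[of "t + x" n] that by simp
    have "((\<lambda>n. 1 / ((real n - (x + y)) * (real n - (t + x)))) has_sum V) {1..}"
      using V(1) tx by (simp add: add_ac)
    then have "((\<lambda>z. ?g z * t ^ ?et z * y' ^ 0 * y ^ ?ey z * x ^ ?ex z) has_sum V) ?E"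
    proof (rule has_sum_Sigma_nonneg[rotated])
      fix n :: nat assume "n \<in> {1..}"
      then show "((\<lambda>p. ?g (n, p) * t ^ ?et (n, p) * y' ^ 0 * y ^ ?ey (n, p) * x ^ ?ex (n, p))
          has_sum (1 / ((real n - (x + y)) * (real n - (t + x))))) UNIV"
        using has_sum_simple_coeff[of x y t n] that by (simp add: case_prod_unfold)
    qed (use that simple_coeff_nonneg in \<open>auto intro!: mult_nonneg_nonneg\<close>)
    moreover have "((\<lambda>z. block_val z * t ^ ?dt z * y' ^ 0 * y ^ ?dy z * x ^ ?dx z) has_sum V) ?D"
      using has_sum_blocks[where x = x and y = y and t = t and V = V and N = 0] V(2) that by (simp add: block_val_def case_prod_unfold)
    ultimately show ?thesis by blast
  qed
  from has_sum_coefficients_eq4[of "1 / 2" block_val ?dt "\<lambda>_. 0" ?dy ?dx ?D ?g ?et "\<lambda>_. 0" ?ey ?ex ?E s "r - 1" 0 "w - s - r - 1",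
      OF _ this]
  obtain T where T: "(block_val has_sum T) {z\<in>?D. ?dx z = s \<and> ?dy z = r - 1 \<and> 0 = (0::nat) \<and> ?dt z = w - s - r - 1}"
    "(?g has_sum T) {z\<in>?E. ?ex z = s \<and> ?ey z = r - 1 \<and> 0 = (0::nat) \<and> ?et z = w - s - r - 1}"
    by auto
  have sc: "simple_coeff n (r - 1, w - s - r - 1, s) = real ((w - 1) choose s) * (1 / real n ^ w)" for n
  proof -
    have "s + (r - 1) + (w - s - r - 1) + 2 = w" "s + (r - 1 + (w - s - r - 1) + 1) = w - 1"
      using assms by linarith+
    then show ?thesis by (simp only: simple_coeff_def prod.case) simp
  qed
  have "{z\<in>?D. ?dx z = s \<and> ?dy z = r - 1 \<and> 0 = (0::nat) \<and> ?dt z = w - s - r - 1} = block_set s r w"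
  proof -
    have "?dx z = s \<and> ?dy z = r - 1 \<and> 0 = (0::nat) \<and> ?dt z = w - s - r - 1 \<longleftrightarrow>
      (\<lambda>(k, l, a, b). length k = r \<and> length l = s \<and> sum_list k + sum_list l = w) z" if "z \<in> blocks 0" for z
    proof -
      obtain k l a b where z: "z = (k, l, a, b)" by (cases z) auto
      have "length k + length l + 1 \<le> sum_list k + sum_list l" "0 < length k"
        using that blocks_weight_ge[of k l a b 0] by (auto simp: z blocks_def)
      then have "length k - 1 = r - 1 \<longleftrightarrow> length k = r"
        "length l = s \<Longrightarrow> length k = r \<Longrightarrow> sum_list k + sum_list l - length k - length l - 1 = w - s - r - 1 \<longleftrightarrow>
          sum_list k + sum_list l = w"
        using assms by linarith+
      then show ?thesis unfolding z prod.case by blast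
    qed
    then show ?thesis by (auto simp: block_set_def)
  qed
  moreover have "((\<lambda>n. real ((w - 1) choose s) * (1 / real n ^ w)) has_sum T) {1..} \<longleftrightarrow>
    (?g has_sum T) {z\<in>?E. ?ex z = s \<and> ?ey z = r - 1 \<and> 0 = (0::nat) \<and> ?et z = w - s - r - 1}"
    by (rule has_sum_reindex_bij_witness[of _ fst "\<lambda>n. (n, r - 1, w - s - r - 1, s)"])
      (auto simp: sc[unfolded diff_diff_left] simp flip: One_nat_def)
  moreover have "((\<lambda>n. real ((w - 1) choose s) * (1 / real n ^ w)) has_sum (real ((w - 1) choose s) * mzv [w])) {1..}"
    using assms by (intro has_sum_cmult_right has_sum_inverse_power) auto
  ultimately show ?thesis
    using T has_sum_unique by (metis (no_types, lifting))
qed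

section \<open>The recursion and its initial value\<close>

text \<open>Convergence comes from the blocks of depth 2 with empty \<open>l\<close>: the pairs n <
  m with exponents \<open>[w1, w2]\<close> form a subfamily. The weak chain is then the single
  shared entry \<open>[m]\<close>.\<close>

lemma has_sum_mzv_2:
  assumes "1 \<le> w1" "2 \<le> w2"
  shows "((\<lambda>(n, m). 1 / real n ^ w1 * (1 / real m ^ w2)) has_sum mzv [w1, w2]) (SIGMA n:{1..}. {n<..})"
proof -
  let ?P = "(SIGMA n:{1..}. {n<..}) :: (nat \<times> nat) set"
  let ?f = "\<lambda>(n, m). 1 / real n ^ w1 * (1 / real m ^ w2)"
  let ?e = "\<lambda>(n, m). ([w1, w2], [] :: nat list, [n, m], [m])"
  have "block_val summable_on (block_set 0 2 (w1 + w2))"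
    using has_sum_block_set[of 2 0 "w1 + w2"] assms by (auto simp: summable_on_def)
  then have "block_val summable_on ?e ` ?P"
    by (rule summable_on_subset_banach)
      (use assms in \<open>auto simp: block_set_def blocks_def admissible_def is_index_def\<close>)
  then have "(block_val \<circ> ?e) summable_on ?P"
    by (subst (asm) summable_on_reindex) (auto simp: inj_on_def)
  then have "?f summable_on ?P"
    by (simp add: o_def case_prod_unfold block_val_def)
  moreover have "infsum ?f ?P = mzv [w1, w2]"
    unfolding mzv_def
    by (rule infsum_reindex_bij_witness[of _ "\<lambda>m. (m ! 0, m ! 1)" "\<lambda>(n, m). [n, m]"])
      (auto simp: length_Suc_conv numeral_2_eq_2)
  ultimately show ?thesis by (simp add: has_sum_iff)
qed

text \<open>The sum formula in depth two, read off from \<open>has_sum_block_set\<close> with s = 0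
  and r = 2.\<close>

lemma sum_mzv_2:
  assumes "3 \<le> w"
  shows "(\<Sum>(w1, w2)\<in>{(w1, w2). w1 \<ge> 1 \<and> w2 \<ge> 2 \<and> w1 + w2 = w}. mzv [w1, w2]) = mzv [w]"
proof -
  let ?P = "(SIGMA n:{1..}. {n<..}) :: (nat \<times> nat) set"
  let ?W = "{(w1, w2). w1 \<ge> 1 \<and> w2 \<ge> 2 \<and> w1 + w2 = w}"
  let ?F = "\<lambda>((w1, w2), (n, m)). 1 / real n ^ w1 * (1 / real m ^ w2)"
  have fin: "finite ?W"
    by (rule finite_subset[of _ "{..w} \<times> {..w}"]) auto
  have "(block_val has_sum mzv [w]) (block_set 0 2 w)"
    using has_sum_block_set[of 2 0 w] assms by simp
  moreover have "(?F has_sum T) (?W \<times> ?P) \<longleftrightarrow> (block_val has_sum T) (block_set 0 2 w)" for T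
    by (rule has_sum_reindex_bij_witness[of _ "\<lambda>(k, l, a, b). ((k ! 0, k ! 1), (a ! 0, a ! 1))"
          "\<lambda>((w1, w2), (n, m)). ([w1, w2], [], [n, m], [m])"])
      (auto simp: block_set_def block_val_def blocks_def admissible_def is_index_def length_Suc_conv numeral_2_eq_2)
  ultimately have "(?F has_sum mzv [w]) (?W \<times> ?P)" by simp
  then have "((\<lambda>(w1, w2). mzv [w1, w2]) has_sum mzv [w]) ?W"
    by (rule has_sum_SigmaD) (use has_sum_mzv_2 in \<open>auto simp: case_prod_unfold\<close>)
  then show ?thesis
    using fin by (simp add: has_sum_finite_iff)
qed

section \<open>Pairs of blocks with and without the linking condition\<close>

definition pair_val ::
    "(nat list \<times> nat list \<times> nat list \<times> nat list) \<times> (nat list \<times> nat list \<times> nat list \<times> nat list) \<Rightarrow> real"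
  where "pair_val = (\<lambda>(z1, z2). block_val z1 * block_val z2)"

definition free_pairs :: "nat \<Rightarrow> nat \<Rightarrow> nat \<Rightarrow> nat \<Rightarrow> nat \<Rightarrow>
    ((nat list \<times> nat list \<times> nat list \<times> nat list) \<times> (nat list \<times> nat list \<times> nat list \<times> nat list)) set"
  where "free_pairs w s1 s2 r1 r2 = {((k1, l1, a1, b1), (k2, l2, a2, b2)).
    (k1, l1, a1, b1) \<in> blocks 0 \<and> (k2, l2, a2, b2) \<in> blocks 0 \<and>
    length k1 = r1 \<and> length l1 = s1 \<and> length k2 = r2 \<and> length l2 = s2 \<and>
    sum_list k1 + sum_list k2 + sum_list l1 + sum_list l2 = w}"

definition linked_pairs :: "nat \<Rightarrow> nat \<Rightarrow> nat \<Rightarrow> nat \<Rightarrow> nat \<Rightarrow>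
    ((nat list \<times> nat list \<times> nat list \<times> nat list) \<times> (nat list \<times> nat list \<times> nat list \<times> nat list)) set"
  where "linked_pairs w s1 s2 r1 r2 =
    {((k1, l1, a1, b1), (k2, l2, a2, b2)) \<in> free_pairs w s1 s2 r1 r2. hd b2 < hd a1}"

text \<open>The value 0 below the least possible weight of a block lets convolutions run over all
  splittings of w.\<close>

definition block_zeta :: "nat \<Rightarrow> nat \<Rightarrow> nat \<Rightarrow> real"
  where "block_zeta s r w = (if s + r + 1 \<le> w then real ((w - 1) choose s) * mzv [w] else 0)"

lemma has_sum_block_zeta: "0 < r \<Longrightarrow> (block_val has_sum block_zeta s r w) (block_set s r w)"
  using has_sum_block_set[of r s w] block_set_empty[of w s r] by (auto simp: block_zeta_def)

lemma has_sum_free_pairs: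
  assumes "0 < r1" "0 < r2"
  shows "(pair_val has_sum (\<Sum>w1\<le>w. block_zeta s1 r1 w1 * block_zeta s2 r2 (w - w1))) (free_pairs w s1 s2 r1 r2)"
proof -
  let ?F = "\<lambda>(w1, z). pair_val z"
  let ?A = "SIGMA w1:{..w}. block_set s1 r1 w1 \<times> block_set s2 r2 (w - w1)"
  have "((\<lambda>(z1, z2). block_val z1 * block_val z2) has_sum (block_zeta s1 r1 w1 * block_zeta s2 r2 (w - w1)))
      (block_set s1 r1 w1 \<times> block_set s2 r2 (w - w1))" for w1
    using assms by (intro has_sum_product_nonneg has_sum_block_zeta block_val_nonneg)
  then have "(?F has_sum (\<Sum>w1\<le>w. block_zeta s1 r1 w1 * block_zeta s2 r2 (w - w1))) ?A"
    by (intro has_sum_Sigma_nonneg[OF _ has_sum_finite]) (auto simp: pair_val_def block_val_nonneg)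
  moreover have "(?F has_sum T) ?A \<longleftrightarrow> (pair_val has_sum T) (free_pairs w s1 s2 r1 r2)" for T
    by (rule has_sum_reindex_bij_witness[of _ "\<lambda>z. (sum_list (fst (fst z)) + sum_list (fst (snd (fst z))), z)" snd])
      (auto simp: block_set_def free_pairs_def)
  ultimately show ?thesis by simp
qed

text \<open>Linked pairs are a subfamily of the free pairs and hence summable. This is what makes
  the infinite sums in the definition of \<open>S\<close> genuine values rather than the default 0,
  and permits summing over entries and exponents in either order.\<close>

lemma has_sum_linked_pairs:
  assumes "0 < r1" "0 < r2"
  shows "(pair_val has_sum S w s1 s2 r1 r2) (linked_pairs w s1 s2 r1 r2)"
proof -
  have "pair_val summable_on linked_pairs w s1 s2 r1 r2"
    by (rule summable_on_subset_banach[OF has_sum_imp_summable[OF has_sum_free_pairs[OF assms]]])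
      (auto simp: linked_pairs_def)
  then obtain T where T: "(pair_val has_sum T) (linked_pairs w s1 s2 r1 r2)"
    by (auto simp: summable_on_def)
  let ?F = "\<lambda>((k1, k2, l1, l2), (a1, a2, b1, b2)).
    (recip_prod k1 a1 * recip_prod l1 b1) * (recip_prod k2 a2 * recip_prod l2 b2)"
  let ?I = "S_indices w s1 s2 r1 r2" and ?D = "S_domain s1 s2 r1 r2"
  let ?i = "\<lambda>((k1, l1, a1, b1), (k2, l2, a2, b2)). ((k1, k2, l1, l2), (a1, a2, b1, b2))"
  let ?j = "\<lambda>((k1, k2, l1, l2), (a1, a2, b1, b2)). ((k1, l1, a1, b1), (k2, l2, a2, b2))"
  have j: "?j p \<in> linked_pairs w s1 s2 r1 r2 \<longleftrightarrow> p \<in> ?I \<times> ?D" for p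
  proof -
    obtain k1 k2 l1 l2 a1 a2 b1 b2 where p: "p = ((k1, k2, l1, l2), (a1, a2, b1, b2))"
      by (metis surj_pair)
    show ?thesis
      using assms by (auto simp: p linked_pairs_def free_pairs_def blocks_def S_indices_def S_domain_def)
  qed
  have "(?F has_sum T) (?I \<times> ?D) \<longleftrightarrow> (pair_val has_sum T) (linked_pairs w s1 s2 r1 r2)"
  proof (rule has_sum_reindex_bij_witness[of _ ?i ?j])
    fix p :: "(nat list \<times> nat list \<times> nat list \<times> nat list) \<times> (nat list \<times> nat list \<times> nat list \<times> nat list)"
    show "?i (?j p) = p" by (auto split: prod.split)
    show "p \<in> ?I \<times> ?D \<Longrightarrow> ?j p \<in> linked_pairs w s1 s2 r1 r2" by (simp add: j)
    show "pair_val (?j p) = ?F p" by (auto simp: pair_val_def block_val_def split: prod.split)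
  next
    fix q :: "(nat list \<times> nat list \<times> nat list \<times> nat list) \<times> (nat list \<times> nat list \<times> nat list \<times> nat list)"
    show q: "?j (?i q) = q" by (auto split: prod.split)
    show "q \<in> linked_pairs w s1 s2 r1 r2 \<Longrightarrow> ?i q \<in> ?I \<times> ?D" using j[of "?i q"] by (simp only: q)
  qed simp
  with T have F: "(?F has_sum T) (?I \<times> ?D)" by simp
  have "((\<lambda>q. \<Sum>\<^sub>\<infinity>z\<in>?D. ?F (q, z)) has_sum T) ?I"
    by (rule has_sum_SigmaD[OF F])
      (use summable_on_SigmaD1[OF has_sum_imp_summable[OF F]] in \<open>auto intro!: has_sum_infsum\<close>)
  then have "T = (\<Sum>q\<in>?I. \<Sum>\<^sub>\<infinity>z\<in>?D. ?F (q, z))"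
    using finite_S_indices by (simp add: has_sum_finite_iff)
  also have "\<dots> = S w s1 s2 r1 r2"
    unfolding S_def by (intro sum.cong refl) (auto split: prod.split)
  finally show ?thesis using T by simp
qed

text \<open>If \<open>b\<^sub>2\<^sub>,\<^sub>1\<close> is moved to the front of \<open>a\<^sub>1\<close>, the remaining weak chain starts at or above the new
  first entry, which is exactly what the linking condition excludes.\<close>

lemma S_recursion:
  assumes "0 < r1" "0 < r2"
  shows "S w s1 (Suc s2) r1 r2 + S w s1 s2 (Suc r1) r2 =
    (\<Sum>w1\<le>w. block_zeta s1 (Suc r1) w1 * block_zeta s2 r2 (w - w1))"
proof -
  let ?R = "free_pairs w s1 s2 (Suc r1) r2 - linked_pairs w s1 s2 (Suc r1) r2"
  let ?j = "\<lambda>((k1, l1, a1, b1), (k2, l2, a2, b2)).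
    ((hd l2 # k1, l1, hd b2 # a1, b1), (k2, tl l2, a2, tl b2)) ::
    (nat list \<times> nat list \<times> nat list \<times> nat list) \<times> (nat list \<times> nat list \<times> nat list \<times> nat list)"
  let ?i = "\<lambda>((k1, l1, a1, b1), (k2, l2, a2, b2)).
    ((tl k1, l1, tl a1, b1), (k2, hd k1 # l2, a2, hd a1 # b2)) ::
    (nat list \<times> nat list \<times> nat list \<times> nat list) \<times> (nat list \<times> nat list \<times> nat list \<times> nat list)"
  \<comment> \<open>The exponent \<open>hd l2\<close> moves together with its entry. Since r1 > 0,
    the last entry of \<open>k1\<close>, on which admissibility depends, stays in place; linking
    makes the longer \<open>a1\<close> strictly increasing.\<close>
  have "(pair_val has_sum T) (linked_pairs w s1 (Suc s2) r1 r2) \<longleftrightarrow> (pair_val has_sum T) ?R" for T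
  proof (rule has_sum_reindex_bij_witness[of _ ?i ?j])
    fix p assume "p \<in> linked_pairs w s1 (Suc s2) r1 r2"
    moreover obtain k1 l1 a1 b1 k2 l2 a2 b2 where p: "p = ((k1, l1, a1, b1), (k2, l2, a2, b2))"
      by (metis surj_pair)
    ultimately have *: "((k1, l1, a1, b1), (k2, l2, a2, b2)) \<in> linked_pairs w s1 (Suc s2) r1 r2" by simp
    then obtain x l where l2: "l2 = x # l"
      by (cases l2) (auto simp: linked_pairs_def free_pairs_def)
    from * obtain y c b where b2: "b2 = y # c # b"
      by (cases b2; cases "tl b2") (auto simp: linked_pairs_def free_pairs_def blocks_def)
    from * assms obtain z a where a1: "a1 = z # a"
      by (cases a1) (auto simp: linked_pairs_def free_pairs_def blocks_def)
    show "?i (?j p) = p" by (simp add: p l2 b2)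
    show "?j p \<in> ?R" using *
      by (auto simp: p l2 b2 a1 linked_pairs_def free_pairs_def blocks_def admissible_def is_index_def)
    show "pair_val (?j p) = pair_val p"
      by (simp add: p l2 b2 pair_val_def block_val_def)
  next
    fix p assume "p \<in> ?R"
    moreover obtain k1 l1 a1 b1 k2 l2 a2 b2 where p: "p = ((k1, l1, a1, b1), (k2, l2, a2, b2))"
      by (metis surj_pair)
    ultimately have *: "((k1, l1, a1, b1), (k2, l2, a2, b2)) \<in> ?R" by simp
    then obtain x x' k where k1: "k1 = x # x' # k" using assms
      by (cases k1; cases "tl k1") (auto simp: linked_pairs_def free_pairs_def blocks_def)
    from * assms obtain y y' a where a1: "a1 = y # y' # a"
      by (cases a1; cases "tl a1") (auto simp: k1 linked_pairs_def free_pairs_def blocks_def)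
    from * obtain z b where b2: "b2 = z # b"
      by (cases b2) (auto simp: linked_pairs_def free_pairs_def blocks_def)
    show "?j (?i p) = p" by (simp add: p k1 a1)
    have bl: "(x # x' # k, l1, y # y' # a, b1) \<in> blocks 0" "(k2, l2, a2, z # b) \<in> blocks 0" "y \<le> z"
      and wt: "length (x # x' # k) = Suc r1" "length l1 = s1" "length k2 = r2" "length l2 = s2"
        "sum_list (x # x' # k) + sum_list k2 + sum_list l1 + sum_list l2 = w"
      using * by (auto simp: k1 a1 b2 linked_pairs_def free_pairs_def)
    have "(x' # k, l1, y' # a, b1) \<in> blocks 0"
      using bl(1) by (simp add: blocks_def admissible_def is_index_def)
    moreover have "(k2, x # l2, a2, y # z # b) \<in> blocks 0"
      using bl by (auto simp: blocks_def admissible_def is_index_def)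
    moreover have "y < y'"
      using bl(1) by (simp add: blocks_def)
    ultimately show "?i p \<in> linked_pairs w s1 (Suc s2) r1 r2"
      using wt by (simp add: p k1 b2 a1 linked_pairs_def free_pairs_def)
  qed simp
  then have "(pair_val has_sum S w s1 (Suc s2) r1 r2) ?R"
    by (rule iffD1) (rule has_sum_linked_pairs[OF assms])
  moreover have "(pair_val has_sum S w s1 s2 (Suc r1) r2) (linked_pairs w s1 s2 (Suc r1) r2)"
    using assms by (intro has_sum_linked_pairs) auto
  ultimately have "(pair_val has_sum (S w s1 (Suc s2) r1 r2 + S w s1 s2 (Suc r1) r2))
      (?R \<union> linked_pairs w s1 s2 (Suc r1) r2)"
    by (intro has_sum_Un_disjoint) auto
  moreover have "?R \<union> linked_pairs w s1 s2 (Suc r1) r2 = free_pairs w s1 s2 (Suc r1) r2"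
    by (auto simp: linked_pairs_def)
  ultimately show ?thesis
    using has_sum_free_pairs[of "Suc r1" r2 w s1 s2] assms by (auto intro: has_sum_unique)
qed

text \<open>For s2 = 0 the second block is a strict chain ending at N, and the first is a block
  above N, so the generating function is a sum over N of two known factors. The double
  transformation separates it into a sum over n < m of two simple factors, the first with x, y, t
  and the second with x, y', t. Since x and t are shared, s splits as t1 + t2 and the weight as w1 +
  w2; nonnegative excess means t1 + r1 < w1 and t2 + r2 < w2.\<close>

lemma S_zero:
  assumes "0 < r1" "0 < r2" "s + r1 + r2 + 2 \<le> w"
  shows "S w s 0 r1 r2 =
    (\<Sum>(w1, w2, t1, t2)\<in>{(w1, w2, t1, t2). w1 + w2 = w \<and> t1 + t2 = s \<and> t1 + r1 < w1 \<and> t2 + r2 < w2}.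
      real ((w1 - 1) choose t1) * real ((w2 - 1) choose t2) * mzv [w1, w2])"
proof -
  let ?D = "SIGMA N:{1..}. chain_pairs 0 N \<times> blocks N"
  let ?f = "\<lambda>(N, (k', a'), z). recip_prod k' a' * block_val z" 
  let ?dx = "\<lambda>(N, (k', a'), (k, l, a, b)). length l" and ?dy = "\<lambda>(N, (k', a'), (k, l, a, b)). length k - 1"
    and ?dy' = "\<lambda>(N, (k', a'), (k, l, a, b)). length k' - 1"
    and ?dt = "\<lambda>(N, (k', a'), (k, l, a, b)).
      (sum_list k' - length k' - 1) + (sum_list k + sum_list l - length k - length l - 1)"
  let ?P = "(SIGMA n:{1..}. {n<..}) :: (nat \<times> nat) set"
  let ?E = "?P \<times> (UNIV :: ((nat \<times> nat \<times> nat) \<times> (nat \<times> nat \<times> nat)) set)"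
  let ?g = "\<lambda>((n, m), (p, q)). simple_coeff n p * simple_coeff m q"
  let ?ex = "\<lambda>((n, m), ((\<rho>, e, s), (\<rho>', e', s'))). s + s'" and ?ey = "\<lambda>((n, m), ((\<rho>, e, s), (\<rho>', e', s'))). \<rho>"
    and ?ey' = "\<lambda>((n, m), ((\<rho>, e, s), (\<rho>', e', s'))). \<rho>'" and ?et = "\<lambda>((n, m), ((\<rho>, e, s), (\<rho>', e', s'))). e + e'"
  have gf: "\<exists>T. ((\<lambda>z. ?f z * t ^ ?dt z * y' ^ ?dy' z * y ^ ?dy z * x ^ ?dx z) has_sum T) ?D \<and>
      ((\<lambda>z. ?g z * t ^ ?et z * y' ^ ?ey' z * y ^ ?ey z * x ^ ?ex z) has_sum T) ?E"
    if "0 < x" "x < 1 / 2" "0 < y" "y < 1 / 2" "0 < y'" "y' < 1 / 2" "0 < t" "t < 1 / 2" for x y y' t :: real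
  proof -
    have lt: "t - y < 1" "t - y' < 1" "t + x < 1" "t + x - (t - y) < 1" "t + x - (t - y') < 1" "t < 1" using that by simp_all
    note pos = shifted_prod_pos[OF lt(1)] shifted_prod_pos[OF lt(2)] shifted_prod_pos[OF lt(3)] shifted_prod_pos[OF lt(6)]
    from shifted_prod_double_transformation[OF lt(1-5)]
    obtain W where W: "((\<lambda>(N, m). shifted_prod (N - 1) (t - y') / (real N * shifted_prod N (t - y)) *
                (shifted_prod (m - 1) (t - y) / (real m * shifted_prod m (t + x)))) has_sum W) (SIGMA N:{1..}. {N<..})"
       "((\<lambda>(n, m). 1 / ((real n - (t + x - (t - y))) * (real n - (t + x))) *
                (1 / ((real m - (t + x - (t - y'))) * (real m - (t + x))))) has_sum W) ?P"
      by blast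
    have "((\<lambda>z. ?g z * t ^ ?et z * y' ^ ?ey' z * y ^ ?ey z * x ^ ?ex z) has_sum W) ?E"
    proof (rule has_sum_Sigma_nonneg[OF _ W(2)])
      fix nm assume "nm \<in> ?P"
      then obtain n m where nm: "nm = (n, m)" "1 \<le> n" "1 \<le> m" by auto
      have "((\<lambda>(p, q). (\<lambda>(\<rho>, e, s). simple_coeff n (\<rho>, e, s) * t ^ e * y ^ \<rho> * x ^ s) p *
            (\<lambda>(\<rho>, e, s). simple_coeff m (\<rho>, e, s) * t ^ e * y' ^ \<rho> * x ^ s) q) has_sum
          (1 / ((real n - (x + y)) * (real n - (t + x))) * (1 / ((real m - (x + y')) * (real m - (t + x)))))) (UNIV \<times> UNIV)"
        using that nm
        by (intro has_sum_product_nonneg has_sum_simple_coeff)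
          (auto intro!: mult_nonneg_nonneg simple_coeff_nonneg split: prod.split)
      then show "((\<lambda>pq. ?g (nm, pq) * t ^ ?et (nm, pq) * y' ^ ?ey' (nm, pq) * y ^ ?ey (nm, pq) * x ^ ?ex (nm, pq)) has_sum
          (\<lambda>(n, m). 1 / ((real n - (t + x - (t - y))) * (real n - (t + x))) *
                (1 / ((real m - (t + x - (t - y'))) * (real m - (t + x))))) nm) UNIV"
        by (simp add: nm case_prod_unfold power_add mult_ac)
    qed (use that simple_coeff_nonneg in \<open>auto intro!: mult_nonneg_nonneg\<close>)
    moreover have "((\<lambda>z. ?f z * t ^ ?dt z * y' ^ ?dy' z * y ^ ?dy z * x ^ ?dx z) has_sum W) ?D"
    proof -
      define v where "v N = (\<Sum>\<^sub>\<infinity>m\<in>{N<..}. shifted_prod (m - 1) (t - y) / (real m * shifted_prod m (t + x)))" for N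
      have v: "((\<lambda>m. shifted_prod (m - 1) (t - y) / (real m * shifted_prod m (t + x))) has_sum v N) {N<..}" for N
        using shifted_prod_transformation[OF lt(1,3,4), of N] unfolding v_def by (auto dest: has_sum_imp_summable)
      have "((\<lambda>N. shifted_prod (N - 1) (t - y') / (real N * shifted_prod N (t - y)) * v N) has_sum W) {1..}"
        by (rule has_sum_SigmaD[OF W(1)]) (unfold prod.case, rule has_sum_cmult_right[OF v])
      then show ?thesis
      proof (rule has_sum_Sigma_nonneg[rotated])
        fix N :: nat assume N: "N \<in> {1..}"
        have "((\<lambda>(c, z). (\<lambda>(k, a). recip_prod k a * y' ^ (length k - 1) * t ^ (sum_list k - length k - 1)) c *
           (\<lambda>(k, l, a, b). recip_prod k a * recip_prod l b * t ^ (sum_list k + sum_list l - length k - length l - 1) *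
      y ^ (length k - 1) * x ^ length l) z) has_sum
           (shifted_prod (N - 1) (t - y') / shifted_prod 0 (t - y') * (shifted_prod 0 t / (real N * shifted_prod N t)) *
            (shifted_prod N t / shifted_prod N (t - y) * v N))) (chain_pairs 0 N \<times> blocks N)"
          using that N v
          by (intro has_sum_product_nonneg has_sum_chains has_sum_blocks)
            (auto intro!: mult_nonneg_nonneg recip_prod_nonneg split: prod.split)
        \<comment> \<open>\<open>shifted_prod N t\<close> cancels between the chain and the block,
          leaving the left-hand family of the double transformation with x, x', y replaced by t - y,
          t - y', t + x.\<close>
        moreover have "shifted_prod (N - 1) (t - y') / shifted_prod 0 (t - y') * (shifted_prod 0 t / (real N * shifted_prod N t)) *
            (shifted_prod N t / shifted_prod N (t - y) * v N) =
            shifted_prod (N - 1) (t - y') / (real N * shifted_prod N (t - y)) * v N"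
          using pos(4)[of N] by simp
        ultimately show "((\<lambda>q. ?f (N, q) * t ^ ?dt (N, q) * y' ^ ?dy' (N, q) * y ^ ?dy (N, q) * x ^ ?dx (N, q)) has_sum
            (shifted_prod (N - 1) (t - y') / (real N * shifted_prod N (t - y)) * v N)) (chain_pairs 0 N \<times> blocks N)"
          by (simp only:) (simp add: block_val_def case_prod_unfold power_add mult_ac)
      qed (use that in \<open>auto intro!: mult_nonneg_nonneg recip_prod_nonneg block_val_nonneg\<close>)
    qed
    ultimately show ?thesis by blast
  qed
  let ?DF = "{z\<in>?D. ?dx z = s \<and> ?dy z = r1 - 1 \<and> ?dy' z = r2 - 1 \<and> ?dt z = w - s - r1 - r2 - 2}"
  let ?EF = "{z\<in>?E. ?ex z = s \<and> ?ey z = r1 - 1 \<and> ?ey' z = r2 - 1 \<and> ?et z = w - s - r1 - r2 - 2}"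
  obtain T where T: "(?f has_sum T) ?DF" "(?g has_sum T) ?EF"
    using has_sum_coefficients_eq4[of "1 / 2" ?f ?dt ?dy' ?dy ?dx ?D ?g ?et ?ey' ?ey ?ex ?E s "r1 - 1" "r2 - 1" "w - s - r1 - r2 - 2",
      OF _ gf] by auto
  let ?i = "\<lambda>((k, l, a, b), (k', l' :: nat list, a', b' :: nat list)). (last a', (k', a'), (k, l, a, b)) ::
    nat \<times> (nat list \<times> nat list) \<times> (nat list \<times> nat list \<times> nat list \<times> nat list)"
  let ?j = "\<lambda>(N, (k', a'), z). (z, (k', [], a', [N])) :: (nat list \<times> nat list \<times> nat list \<times> nat list) \<times> (nat list \<times> nat list \<times> nat list \<times> nat list)"
  have "(?f has_sum T) ?DF \<longleftrightarrow> (pair_val has_sum T) (linked_pairs w s 0 r1 r2)"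
  proof (rule has_sum_reindex_bij_witness[of _ ?i
        ?j])
    show "T = T" ..
  next
    fix p assume "p \<in> ?DF"
    moreover obtain N k' a' k l a b where p: "p = (N, (k', a'), (k, l, a, b))"
      by (metis surj_pair)
    ultimately have 1: "1 \<le> N" "(k', a') \<in> chain_pairs 0 N" "(k, l, a, b) \<in> blocks N"
      and 2: "length l = s" "length k - 1 = r1 - 1" "length k' - 1 = r2 - 1"
        "(sum_list k' - length k' - 1) + (sum_list k + sum_list l - length k - length l - 1) = w - s - r1 - r2 - 2"
      by auto
    have ne: "k \<noteq> []" "k' \<noteq> []" "a \<noteq> []" and N: "last a' = N" using 1 by (auto simp: chain_pairs_def blocks_def)
    have "0 < length k" "0 < length k'" using ne by simp_all
    then have 3: "length k = r1" "length k' = r2"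
      using 2(2,3) assms(1,2) by linarith+
    have "r2 + 1 \<le> sum_list k'" "r1 + s + 1 \<le> sum_list k + sum_list l"
      using 1 2(1) 3 blocks_weight_ge[of k l a b N] admissible_length_le[of k'] by (auto simp: chain_pairs_def)
    then have 4: "sum_list k + sum_list k' + sum_list l = w"
      using 2(4) assms(3) unfolding 2(1) 3 by linarith
    show "?i (?j p) = p" by (simp add: p N)
    have "(k, l, a, b) \<in> blocks 0" using 1(3) by (auto simp: blocks_def)
    moreover have "(k', [], a', [N]) \<in> blocks 0"
      using 1(1,2) ne by (auto simp: blocks_def chain_pairs_def is_index_def)
    moreover have "N < hd a" using 1(3) ne by (auto simp: blocks_def)
    ultimately show "?j p \<in> linked_pairs w s 0 r1 r2"
      using 2(1) 3 4 by (simp add: p linked_pairs_def free_pairs_def)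
    show "pair_val (?j p) = ?f p" by (simp add: p pair_val_def block_val_def mult_ac)
  next
    fix p assume "p \<in> linked_pairs w s 0 r1 r2"
    moreover obtain k l a b k' l' a' b' where p: "p = ((k, l, a, b), (k', l', a', b'))"
      by (metis surj_pair)
    ultimately have 1: "(k, l, a, b) \<in> blocks 0" "(k', l', a', b') \<in> blocks 0" "hd b' < hd a"
      and 2: "length k = r1" "length l = s" "length k' = r2" "l' = []"
        "sum_list k + sum_list k' + sum_list l + sum_list l' = w"
      by (auto simp: linked_pairs_def free_pairs_def)
    then obtain N where N: "b' = [N]" by (auto simp: blocks_def length_Suc_conv)
    have N': "last a' = N" "1 \<le> N" using 1(2) by (auto simp: blocks_def N)
    show "?j (?i p) = p" by (simp add: p 2 N N')
    have "a \<noteq> []" using 1(1) by (auto simp: blocks_def)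
    then have "\<forall>x\<in>set a. N < x" using 1(1,3) by (cases a) (auto simp: blocks_def N)
    then have "(k, l, a, b) \<in> blocks N" using 1(1) by (simp add: blocks_def)
    moreover have "(k', a') \<in> chain_pairs 0 N" using 1(2) N' by (simp add: blocks_def chain_pairs_def)
    moreover have "length k' + 1 \<le> sum_list k'" "length k + length l + 1 \<le> sum_list k + sum_list l"
      using 1 blocks_weight_ge[of k l a b 0] by (auto intro!: admissible_length_le[simplified] simp: blocks_def)
    then have "(sum_list k' - length k' - 1) + (sum_list k + sum_list l - length k - length l - 1) = w - s - r1 - r2 - 2"
      using 2 by simp
    ultimately show "?i p \<in> ?DF" using 2 N' by (simp add: p)
  qed
  then have TS: "T = S w s 0 r1 r2"
    using T has_sum_linked_pairs[OF assms(1,2)] has_sum_unique by blast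
  let ?F = "{(w1, w2, t1, t2). w1 + w2 = w \<and> t1 + t2 = s \<and> t1 + r1 < w1 \<and> t2 + r2 < w2}"
  let ?G = "\<lambda>((w1, w2, t1, t2), (n, m)). real ((w1 - 1) choose t1) * real ((w2 - 1) choose t2) *
    (1 / real n ^ w1 * (1 / real m ^ w2))"
  have fin: "finite ?F"
    by (rule finite_subset[of _ "{..w} \<times> {..w} \<times> {..s} \<times> {..s}"]) auto
  have sc: "simple_coeff n (r - 1, v - t - r - 1, t) = real ((v - 1) choose t) * (1 / real n ^ v)"
    if "0 < r" "t + r < v" for n r t v
  proof -
    have "t + (r - 1) + (v - t - r - 1) + 2 = v" "t + (r - 1 + (v - t - r - 1) + 1) = v - 1"
      using that by linarith+
    then show ?thesis by (simp only: simple_coeff_def prod.case) simp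
  qed
  have "(?G has_sum T) (?F \<times> ?P) \<longleftrightarrow> (?g has_sum T) ?EF"
  proof (rule has_sum_reindex_bij_witness[of _ "\<lambda>((n, m), ((\<rho>, e, t1), (\<rho>', e', t2))).
        ((t1 + \<rho> + e + 2, t2 + \<rho>' + e' + 2, t1, t2), (n, m))"
        "\<lambda>((w1, w2, t1, t2), (n, m)). ((n, m), ((r1 - 1, w1 - t1 - r1 - 1, t1), (r2 - 1, w2 - t2 - r2 - 1, t2)))"])
    fix p assume "p \<in> ?F \<times> ?P"
    then obtain w1 w2 t1 t2 n m where p: "p = ((w1, w2, t1, t2), (n, m))"
      and F: "w1 + w2 = w" "t1 + t2 = s" "t1 + r1 < w1" "t2 + r2 < w2" "1 \<le> n" "n < m" by auto
    show "?g ((\<lambda>((w1, w2, t1, t2), (n, m)). ((n, m), ((r1 - 1, w1 - t1 - r1 - 1, t1), (r2 - 1, w2 - t2 - r2 - 1, t2)))) p) = ?G p"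
      using assms F by (simp only: p prod.case sc) simp
  qed (use assms in auto)
  then have G: "(?G has_sum T) (?F \<times> ?P)" using T by simp
  have "((\<lambda>(w1, w2, t1, t2). real ((w1 - 1) choose t1) * real ((w2 - 1) choose t2) * mzv [w1, w2]) has_sum T) ?F"
  proof (rule has_sum_SigmaD[OF G])
    fix q assume "q \<in> ?F"
    then obtain w1 w2 t1 t2 where q: "q = (w1, w2, t1, t2)" "1 \<le> w1" "2 \<le> w2" using assms by auto
    show "((\<lambda>z. ?G (q, z)) has_sum (\<lambda>(w1, w2, t1, t2). real ((w1 - 1) choose t1) * real ((w2 - 1) choose t2) *
        mzv [w1, w2]) q) ?P"
      using has_sum_cmult_right[OF has_sum_mzv_2[OF q(2,3)]] by (simp add: q case_prod_unfold)
  qed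
  then show ?thesis using fin by (simp add: has_sum_finite_iff TS)
qed

section \<open>Partial fractions and the double shuffle relation\<close>

text \<open>The number of compositions of u into q positive parts: the binomial coefficient of u - 1
  over q - 1, with value 1 at u = q = 0. With this convention Pascal's rule has no boundary
  exceptions.\<close>

fun pf_coeff :: "nat \<Rightarrow> nat \<Rightarrow> nat" where
  "pf_coeff 0 0 = 1"
| "pf_coeff (Suc u) 0 = 0"
| "pf_coeff 0 (Suc q) = 0"
| "pf_coeff (Suc u) (Suc q) = u choose q"

lemma pf_coeff_Pascal: "pf_coeff (Suc u) (Suc q) = pf_coeff u q + pf_coeff u (Suc q)"
  by (cases u; cases q) auto

lemma pf_coeff_eq_0: "u < q \<Longrightarrow> pf_coeff u q = 0"
  by (cases u; cases q) auto

lemma pf_coeff_0_right: "pf_coeff u 0 = of_bool (u = 0)"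
  by (cases u) auto

text \<open>Replacing one factor a b by d (a - b) lowers the total degree in a and b by one;
  Pascal's rule merges the two resulting expansions. The intended values are a = 1/(m - T), b = 1/(n
  - T), d = 1/(n - m), but only the ring relation is used.\<close>

lemma partial_fractions:
  fixes a b d :: "'a :: comm_ring_1"
  assumes ab: "a * b = d * (a - b)" and "0 < P + Q"
  shows "a ^ P * b ^ Q = (\<Sum>u<P + Q.
    (-1) ^ (u + Q) * of_nat (pf_coeff u Q) * d ^ u * a ^ (P + Q - u) +
    (-1) ^ P * of_nat (pf_coeff u P) * d ^ u * b ^ (P + Q - u))"
  using assms(2)
proof (induction "P + Q" arbitrary: P Q rule: less_induct)
  case less
  show ?case
  proof (cases "P = 0 \<or> Q = 0")
    case True
    then show ?thesis
    proof
      assume "P = 0"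
      with less.prems have "0 < Q" by simp
      then show ?thesis using \<open>P = 0\<close>
        by (simp add: pf_coeff_eq_0 pf_coeff_0_right if_distrib if_distribR of_bool_def sum.delta cong: if_cong)
    next
      assume "Q = 0"
      with less.prems have "0 < P" by simp
      then show ?thesis using \<open>Q = 0\<close>
        by (simp add: pf_coeff_eq_0 pf_coeff_0_right if_distrib if_distribR of_bool_def sum.delta cong: if_cong)
    qed
  next
    case False
    then obtain p q where pq: "P = Suc p" "Q = Suc q" by (metis not0_implies_Suc)
    have "a ^ P * b ^ Q = (a * b) * (a ^ p * b ^ q)"
      by (simp add: pq mult_ac)
    also have "\<dots> = d * (a ^ Suc p * b ^ q - a ^ p * b ^ Suc q)"
      unfolding ab by (simp add: algebra_simps)
    also have "a ^ Suc p * b ^ q = (\<Sum>u<Suc (p + q).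
        (-1) ^ (u + q) * of_nat (pf_coeff u q) * d ^ u * a ^ (Suc (p + q) - u) +
        (-1) ^ Suc p * of_nat (pf_coeff u (Suc p)) * d ^ u * b ^ (Suc (p + q) - u))"
      using less.hyps[of "Suc p" q] by (simp add: pq)
    also have "a ^ p * b ^ Suc q = (\<Sum>u<Suc (p + q).
        (-1) ^ (u + Suc q) * of_nat (pf_coeff u (Suc q)) * d ^ u * a ^ (Suc (p + q) - u) +
        (-1) ^ p * of_nat (pf_coeff u p) * d ^ u * b ^ (Suc (p + q) - u))"
      using less.hyps[of p "Suc q"] by (simp add: pq)
    also have "d * ((\<Sum>u<Suc (p + q).
        (-1) ^ (u + q) * of_nat (pf_coeff u q) * d ^ u * a ^ (Suc (p + q) - u) +
        (-1) ^ Suc p * of_nat (pf_coeff u (Suc p)) * d ^ u * b ^ (Suc (p + q) - u)) - (\<Sum>u<Suc (p + q).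
        (-1) ^ (u + Suc q) * of_nat (pf_coeff u (Suc q)) * d ^ u * a ^ (Suc (p + q) - u) +
        (-1) ^ p * of_nat (pf_coeff u p) * d ^ u * b ^ (Suc (p + q) - u))) = (\<Sum>u<Suc (p + q).
        (-1) ^ (Suc u + Suc q) * of_nat (pf_coeff (Suc u) (Suc q)) * d ^ Suc u * a ^ (Suc (p + q) - u) +
        (-1) ^ Suc p * of_nat (pf_coeff (Suc u) (Suc p)) * d ^ Suc u * b ^ (Suc (p + q) - u))"
      unfolding sum_subtractf[symmetric] sum_distrib_left pf_coeff_Pascal
      by (intro sum.cong refl) (simp add: algebra_simps)
    also have "\<dots> = (\<Sum>u<Suc (Suc (p + q)).
        (-1) ^ (u + Suc q) * of_nat (pf_coeff u (Suc q)) * d ^ u * a ^ (Suc (Suc (p + q)) - u) +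
        (-1) ^ Suc p * of_nat (pf_coeff u (Suc p)) * d ^ u * b ^ (Suc (Suc (p + q)) - u))"
      by (subst (2) sum.lessThan_Suc_shift) (simp del: pf_coeff.simps(4) sum.lessThan_Suc)
    finally show ?thesis by (simp add: pq)
  qed
qed

text \<open>The expansion of 1/(m - T) as a formal power series in T.\<close>

definition geometric_fps :: "real \<Rightarrow> real fps"
  where "geometric_fps m = Abs_fps (\<lambda>k. 1 / m ^ Suc k)"

lemma geometric_fps_power_nth:
  "fps_nth (geometric_fps m ^ Suc p) k = real ((k + p) choose p) / m ^ (k + p + 1)"
proof (induction p arbitrary: k)
  case (Suc p)
  have "fps_nth (geometric_fps m ^ Suc (Suc p)) k =
      (\<Sum>i\<le>k. real ((i + p) choose p) / m ^ (i + p + 1) * (1 / m ^ Suc (k - i)))"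
    by (subst power_Suc2, simp only: fps_mult_nth Suc.IH atLeast0AtMost) (simp add: geometric_fps_def)
  also have "\<dots> = (\<Sum>i\<le>k. real ((p + i) choose p) * (1 / m ^ (k + Suc p + 1)))"
  proof (intro sum.cong refl)
    fix i assume "i \<in> {..k}"
    then have "k + Suc p + 1 = (i + p + 1) + Suc (k - i)" by simp
    then have "m ^ (k + Suc p + 1) = m ^ (i + p + 1) * m ^ Suc (k - i)" by (simp only: power_add)
    then show "real ((i + p) choose p) / m ^ (i + p + 1) * (1 / m ^ Suc (k - i)) =
        real ((p + i) choose p) * (1 / m ^ (k + Suc p + 1))"
      by (simp only:) (simp add: add.commute)
  qed
  also have "\<dots> = real (\<Sum>i\<le>k. (p + i) choose p) * (1 / m ^ (k + Suc p + 1))"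
    by (simp only: of_nat_sum sum_distrib_right)
  finally show ?case by (simp only: choose_rising_sum(1)) (simp add: add_ac)
qed (simp add: geometric_fps_def)

lemma geometric_fps_mult:
  assumes "m \<noteq> 0" "n \<noteq> 0" "m \<noteq> n"
  shows "geometric_fps m * geometric_fps n = fps_const (1 / (n - m)) * (geometric_fps m - geometric_fps n)"
proof -
  have inv: "(fps_const x - fps_X) * geometric_fps x = 1" if "x \<noteq> 0" for x
    by (rule fps_ext) (use that in \<open>auto simp: geometric_fps_def left_diff_distrib gr0_conv_Suc\<close>)
  have "geometric_fps m - geometric_fps n =
      geometric_fps m * ((fps_const n - fps_X) * geometric_fps n) - geometric_fps n * ((fps_const m - fps_X) * geometric_fps m)"
    using assms by (simp add: inv)
  also have "\<dots> = fps_const (n - m) * (geometric_fps m * geometric_fps n)"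
    by (simp add: algebra_simps flip: fps_const_sub)
  finally have "fps_const (1 / (n - m)) * (geometric_fps m - geometric_fps n) =
      fps_const (1 / (n - m)) * fps_const (n - m) * (geometric_fps m * geometric_fps n)"
    by (simp only: mult.assoc)
  then show ?thesis using assms by simp
qed

lemma geometric_fps_product_nth:
  fixes m n :: real
  shows "fps_nth (geometric_fps m ^ Suc p * geometric_fps n ^ Suc q) k =
    (\<Sum>i=1..k + p + q + 2 - 1. real ((i - 1) choose p) * real ((k + p + q + 2 - i - 1) choose q) *
      (1 / (m ^ i * n ^ (k + p + q + 2 - i))))"
proof -
  define w where "w = k + p + q + 2"
  have "fps_nth (geometric_fps m ^ Suc p * geometric_fps n ^ Suc q) k =
    (\<Sum>i\<le>k. real ((i + p) choose p) / m ^ (i + p + 1) * (real ((k - i + q) choose q) / n ^ (k - i + q + 1)))"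
    unfolding fps_mult_nth by (simp only: geometric_fps_power_nth atLeast0AtMost)
  also have "\<dots> = (\<Sum>i\<in>{p + 1..k + p + 1}. real ((i - 1) choose p) * real ((w - i - 1) choose q) * (1 / (m ^ i * n ^ (w - i))))"
  proof (rule sum.reindex_bij_witness[of _ "\<lambda>i. i - p - 1" "\<lambda>i. i + p + 1"])
    fix i assume "i \<in> {..k}"
    then have e: "w - (i + p + 1) = k - i + q + 1" by (simp add: w_def)
    show "real ((i + p + 1 - 1) choose p) * real ((w - (i + p + 1) - 1) choose q) * (1 / (m ^ (i + p + 1) * n ^ (w - (i + p + 1)))) =
        real ((i + p) choose p) / m ^ (i + p + 1) * (real ((k - i + q) choose q) / n ^ (k - i + q + 1))"
      unfolding e by simp
  qed (auto simp: w_def)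
  also have "\<dots> = (\<Sum>i=1..w - 1. real ((i - 1) choose p) * real ((w - i - 1) choose q) * (1 / (m ^ i * n ^ (w - i))))"
    by (rule sum.mono_neutral_left) (auto simp: w_def not_le)
  finally show ?thesis by (simp only: w_def)
qed

text \<open>Both sides are the coefficient of T^k, k = w - p - q - 2, in 1/(1 - T)^(p + q + 2),
  written on the left as a product of two powers.\<close>

lemma sum_choose_mult_choose:
  assumes "p + q + 2 \<le> w"
  shows "(\<Sum>i=1..w - 1. ((i - 1) choose p) * ((w - i - 1) choose q)) = (w - 1) choose (p + q + 1)"
proof -
  obtain k where w: "w = k + p + q + 2"
    using assms by (metis add.assoc add.commute le_Suc_ex)
  have "fps_nth (geometric_fps 1 ^ Suc p * geometric_fps 1 ^ Suc q) k =
      fps_nth (geometric_fps 1 ^ Suc (p + q + 1)) k"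
    by (simp add: power_add mult_ac)
  then have "real (\<Sum>i=1..w - 1. ((i - 1) choose p) * ((w - i - 1) choose q)) = real ((w - 1) choose (p + q + 1))"
    unfolding geometric_fps_product_nth geometric_fps_power_nth w by (simp add: add_ac)
  then show ?thesis by (simp only: of_nat_eq_iff)
qed

text \<open>The coefficient of T^(w - p - q - 2) in the partial fraction expansion of 1/((m - T)^(p
  + 1) (n - T)^(q + 1)).\<close>

lemma partial_fractions_coefficients:
  fixes m n :: real
  assumes "0 < m" "m < n" "p + q + 2 \<le> w"
  shows "(\<Sum>i=1..w - 1. real ((i - 1) choose p) * real ((w - i - 1) choose q) * (1 / (m ^ i * n ^ (w - i)))) =
    - (\<Sum>u=1..p + q + 1. real ((w - u - 1) choose (p + q + 1 - u)) * (1 / (n - m) ^ u) *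
        ((-1) ^ (u + q) * real ((u - 1) choose q) * (1 / m ^ (w - u)) +
         (-1) ^ p * real ((u - 1) choose p) * (1 / n ^ (w - u))))"
proof -
  define k where "k = w - p - q - 2"
  have w: "w = k + p + q + 2" using assms by (simp add: k_def)
  define A where "A = geometric_fps m"
  define B where "B = geometric_fps n"
  define d where "d = fps_const (1 / (n - m))"
  have dpow: "d ^ u = fps_const (1 / (n - m) ^ u)" for u
    by (simp add: d_def fps_const_power power_one_over)
  have "A * B = d * (A - B)"
    using assms unfolding A_def B_def d_def by (intro geometric_fps_mult) auto
  from partial_fractions[OF this, of "Suc p" "Suc q"]
  have "fps_nth (A ^ Suc p * B ^ Suc q) k = fps_nth (\<Sum>u<Suc (p + q + 1).
    (-1) ^ (u + Suc q) * of_nat (pf_coeff u (Suc q)) * d ^ u * A ^ (p + q + 2 - u) +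
    (-1) ^ Suc p * of_nat (pf_coeff u (Suc p)) * d ^ u * B ^ (p + q + 2 - u)) k" by simp
  \<comment> \<open>The term u = 0 drops out because p + 1 and q + 1 are positive, so that
    \<open>pf_coeff\<close> is 0 there.\<close>
  also have "\<dots> = (\<Sum>u\<in>{1..p + q + 1}. fps_nth (
    (-1) ^ (u + Suc q) * of_nat (pf_coeff u (Suc q)) * d ^ u * A ^ (p + q + 2 - u) +
    (-1) ^ Suc p * of_nat (pf_coeff u (Suc p)) * d ^ u * B ^ (p + q + 2 - u)) k)"
    unfolding fps_sum_nth by (rule sum.mono_neutral_right) (auto simp: not_less_eq_eq)
  also have "\<dots> = (\<Sum>u\<in>{1..p + q + 1}. - (real ((w - u - 1) choose (p + q + 1 - u)) * (1 / (n - m) ^ u) *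
        ((-1) ^ (u + q) * real ((u - 1) choose q) * (1 / m ^ (w - u)) +
         (-1) ^ p * real ((u - 1) choose p) * (1 / n ^ (w - u)))))"
  proof (intro sum.cong refl)
    fix u assume "u \<in> {1..p + q + 1}"
    then obtain j where u: "u = Suc j" and j: "j \<le> p + q" by (cases u) auto
    have e: "p + q + 2 - u = Suc (p + q - j)" "k + (p + q + 1 - u) = w - u - 1" "p + q - j = p + q + 1 - u"
      "w - u - 1 + 1 = w - u" using j by (simp_all add: u w)
    have nth: "fps_nth ((-1) ^ i * of_nat c * d ^ u * geometric_fps x ^ (p + q + 2 - u)) k =
      (-1) ^ i * real c * (1 / (n - m) ^ u) * (real ((w - u - 1) choose (p + q + 1 - u)) / x ^ (w - u))" for i c x
    proof -
      have "(-1 :: real fps) ^ i = fps_const ((-1) ^ i)"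
        by (induction i) (simp_all flip: fps_const_neg)
      then have "(-1 :: real fps) ^ i * of_nat c * d ^ u = fps_const ((-1) ^ i * real c * (1 / (n - m) ^ u))"
        by (simp only: dpow fps_of_nat[symmetric] fps_const_mult)
      then show ?thesis
        by (simp only: fps_mult_left_const_nth e(1) geometric_fps_power_nth) (simp only: e)
    qed
    show "fps_nth ((-1) ^ (u + Suc q) * of_nat (pf_coeff u (Suc q)) * d ^ u * A ^ (p + q + 2 - u) +
    (-1) ^ Suc p * of_nat (pf_coeff u (Suc p)) * d ^ u * B ^ (p + q + 2 - u)) k =
    - (real ((w - u - 1) choose (p + q + 1 - u)) * (1 / (n - m) ^ u) *
        ((-1) ^ (u + q) * real ((u - 1) choose q) * (1 / m ^ (w - u)) +
         (-1) ^ p * real ((u - 1) choose p) * (1 / n ^ (w - u))))"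
      unfolding A_def B_def fps_add_nth nth by (simp add: u algebra_simps)
  qed
  finally show ?thesis
    unfolding A_def B_def w geometric_fps_product_nth by (simp add: sum_negf)
qed

text \<open>The coefficient with which a power (n - m)^(-w1) occurs in the symmetrized partial
  fractions. The indicator is essential: beyond p + q + 1 truncated subtraction would turn the first
  binomial coefficient into 1.\<close>

definition shuffle_coeff :: "nat \<Rightarrow> nat \<Rightarrow> nat \<Rightarrow> nat \<Rightarrow> int"
  where "shuffle_coeff p q w1 w2 = - of_bool (w1 \<le> p + q + 1) * int ((w2 - 1) choose (p + q + 1 - w1)) *
    ((-1) ^ q * int ((w1 - 1) choose q) + (-1) ^ p * int ((w1 - 1) choose p))"

definition stuffle_coeff :: "nat \<Rightarrow> nat \<Rightarrow> nat \<Rightarrow> nat \<Rightarrow> int"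
  where "stuffle_coeff p q w1 w2 = int ((w1 - 1) choose p) * int ((w2 - 1) choose q)"

section \<open>Summation of the partial fractions over pairs m < n\<close>

lemma has_sum_finite_sum:
  fixes f :: "'i \<Rightarrow> 'a \<Rightarrow> 'b :: topological_comm_monoid_add"
  assumes "\<And>i. i \<in> I \<Longrightarrow> (f i has_sum s i) A"
  shows "((\<lambda>x. \<Sum>i\<in>I. f i x) has_sum (\<Sum>i\<in>I. s i)) A"
  using assms by (induction I rule: infinite_finite_induct) (auto intro: has_sum_add)

abbreviation increasing_pairs :: "(nat \<times> nat) set"
  where "increasing_pairs \<equiv> (SIGMA n:{1..}. {n<..})"

text \<open>The difference d = n - m ranges over the positive integers independently of m.\<close>

lemma has_sum_difference_product:
  assumes "2 \<le> u" "2 \<le> v"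
  shows "((\<lambda>(m, n). 1 / (real n - real m) ^ u * (1 / real m ^ v)) has_sum (mzv [u] * mzv [v])) increasing_pairs"
proof -
  have "((\<lambda>(d, m). 1 / real d ^ u * (1 / real m ^ v)) has_sum (mzv [u] * mzv [v])) ({1..} \<times> {1..})"
    using assms by (intro has_sum_product_nonneg has_sum_inverse_power) auto
  then show ?thesis
    by (subst has_sum_reindex_bij_witness[of _ "\<lambda>(d, m). (m, m + d)" "\<lambda>(m, n). (n - m, m)" "{1..} \<times> {1..}"
          "\<lambda>(d, m). 1 / real d ^ u * (1 / real m ^ v)"])
      (auto simp: of_nat_diff)
qed

text \<open>The map from (m, n) to (n - m, n) is an involution of the increasing pairs.\<close>

lemma has_sum_difference_mzv:
  assumes "1 \<le> u" "2 \<le> v"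
  shows "((\<lambda>(m, n). 1 / (real n - real m) ^ u * (1 / real n ^ v)) has_sum mzv [u, v]) increasing_pairs"
  using has_sum_mzv_2[OF assms]
  by (subst has_sum_reindex_bij_witness[of _ "\<lambda>(d, n). (n - d, n)" "\<lambda>(m, n). (n - m, n)" increasing_pairs
          "\<lambda>(d, m). 1 / real d ^ u * (1 / real m ^ v)"])
    (auto simp: of_nat_diff)

lemma has_sum_harmonic_difference:
  "((\<lambda>d. 1 / real d - 1 / real (d + m)) has_sum (\<Sum>j=1..m. 1 / real j)) {1..}"
proof (induction m)
  case (Suc m)
  have "(\<lambda>j. 1 / real (j + Suc m)) \<longlonglongrightarrow> 0"
    using LIMSEQ_ignore_initial_segment[OF lim_1_over_n] by blast
  from telescope_sums'[OF this]
  have "(\<lambda>j. 1 / real (j + Suc m) - 1 / real (Suc j + Suc m)) sums (1 / real (Suc m))"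
    by simp
  then have "((\<lambda>j. 1 / real (j + Suc m) - 1 / real (Suc j + Suc m)) has_sum (1 / real (Suc m))) UNIV"
    by (rule sums_nonneg_imp_has_sum) (simp add: frac_le)
  then have "((\<lambda>d. 1 / real (d + m) - 1 / real (d + Suc m)) has_sum (1 / real (Suc m))) {1..}"
    unfolding has_sum_from_1_iff by simp
  from has_sum_add[OF Suc this] show ?case by (simp add: atLeastAtMostSuc_conv add.commute)
qed simp

text \<open>The sums over n of 1/(n - m) and of 1/n diverge, but their difference sums over n > m to
  the m-th harmonic number. Its terms with j < m give the double zeta value, and j = m gives the
  simple one.\<close>

lemma has_sum_regularized:
  assumes "2 \<le> v"
  shows "((\<lambda>(m, n). (1 / (real n - real m) - 1 / real n) * (1 / real m ^ v)) has_sum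
    (mzv [1, v] + mzv [Suc v])) increasing_pairs"
proof -
  have "((\<lambda>(m, j). 1 / real j ^ 1 * (1 / real m ^ v)) has_sum mzv [1, v]) (SIGMA m:{1..}. {1..<m})"
    using has_sum_mzv_2[of 1 v] assms
    by (subst has_sum_reindex_bij_witness[of _ "\<lambda>(j, m). (m, j)" "\<lambda>(m, j). (j, m)" increasing_pairs
          "\<lambda>(j, m). 1 / real j ^ 1 * (1 / real m ^ v)"]) auto
  then have "((\<lambda>m. \<Sum>j\<in>{1..<m}. 1 / real j * (1 / real m ^ v)) has_sum mzv [1, v]) {1..}"
    by (rule has_sum_SigmaD) (auto intro!: has_sum_finiteI)
  moreover have "((\<lambda>m. 1 / real m ^ Suc v) has_sum mzv [Suc v]) {1..}"
    using assms by (intro has_sum_inverse_power) auto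
  ultimately have "((\<lambda>m. (\<Sum>j\<in>{1..<m}. 1 / real j * (1 / real m ^ v)) + 1 / real m ^ Suc v) has_sum
      (mzv [1, v] + mzv [Suc v])) {1..}"
    by (rule has_sum_add)
  then show ?thesis
  proof (rule has_sum_Sigma_nonneg[rotated])
    fix m n :: nat assume "m \<in> {1..}" "n \<in> {m<..}"
    then show "0 \<le> (case (m, n) of (m, n) \<Rightarrow> (1 / (real n - real m) - 1 / real n) * (1 / real m ^ v))"
      by (auto intro!: mult_nonneg_nonneg simp: frac_le)
  next
    fix m :: nat assume m: "m \<in> {1..}"
    have "((\<lambda>d. (1 / real d - 1 / real (d + m)) * (1 / real m ^ v)) has_sum
        ((\<Sum>j=1..m. 1 / real j) * (1 / real m ^ v))) {1..}"
      by (intro has_sum_cmult_left has_sum_harmonic_difference)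
    moreover have "(\<Sum>j=1..m. 1 / real j) * (1 / real m ^ v) =
        (\<Sum>j\<in>{1..<m}. 1 / real j * (1 / real m ^ v)) + 1 / real m ^ Suc v"
    proof -
      have "{1..m} = insert m {1..<m}" using m by auto
      then show ?thesis by (simp add: add_divide_distrib sum_divide_distrib)
    qed
    ultimately show "((\<lambda>n. case (m, n) of (m, n) \<Rightarrow> (1 / (real n - real m) - 1 / real n) * (1 / real m ^ v)) has_sum
        ((\<Sum>j\<in>{1..<m}. 1 / real j * (1 / real m ^ v)) + 1 / real m ^ Suc v)) {m<..}"
      by (subst has_sum_reindex_bij_witness[of _ "\<lambda>d. d + m" "\<lambda>n. n - m" "{1..}"
          "\<lambda>d. (1 / real d - 1 / real (d + m)) * (1 / real m ^ v)"]) (auto simp: of_nat_diff)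
  qed
qed

lemma mzv_stuffle:
  assumes "2 \<le> u" "2 \<le> v"
  shows "mzv [u] * mzv [v] = mzv [u, v] + mzv [v, u] + mzv [u + v]"
proof -
  let ?f = "\<lambda>(m, n). 1 / real m ^ u * (1 / real n ^ v)"
  have "(?f has_sum mzv [u, v]) increasing_pairs"
    using assms by (intro has_sum_mzv_2) auto
  moreover have "(?f has_sum mzv [v, u]) {(m, n). 1 \<le> n \<and> n < m}"
    using has_sum_mzv_2[of v u] assms
    by (subst has_sum_reindex_bij_witness[of _ "\<lambda>(m, n). (n, m)" "\<lambda>(m, n). (n, m)" increasing_pairs
          "\<lambda>(n, m). 1 / real n ^ v * (1 / real m ^ u)"]) auto
  moreover have "(?f has_sum mzv [u + v]) {(m, n). 1 \<le> m \<and> m = n}"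
    using has_sum_inverse_power[of "u + v"] assms
    by (subst has_sum_reindex_bij_witness[of _ "\<lambda>m. (m, m)" fst "{1..}" "\<lambda>m. 1 / real m ^ (u + v)"])
      (auto simp: power_add)
  ultimately have sum: "(?f has_sum (mzv [u, v] + mzv [v, u] + mzv [u + v]))
      (increasing_pairs \<union> {(m, n). 1 \<le> n \<and> n < m} \<union> {(m, n). 1 \<le> m \<and> m = n})"
    by (intro has_sum_Un_disjoint) auto
  have union: "increasing_pairs \<union> {(m, n). 1 \<le> n \<and> n < m} \<union> {(m, n). 1 \<le> m \<and> m = n} = {1..} \<times> {1..}"
    by auto
  have "(?f has_sum (mzv [u] * mzv [v])) ({1..} \<times> {1..})"
    using assms by (intro has_sum_product_nonneg has_sum_inverse_power) auto
  then show ?thesis using sum unfolding union by (rule has_sum_unique)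
qed

text \<open>Adding the expression with m and n exchanged folds both orders into m < n. Under the
  substitution of w - i for i the second half is the expansion with p and q exchanged, so the two
  partial fraction formulas add up.\<close>

lemma symmetrized_partial_fractions:
  fixes m n :: real
  assumes "0 < m" "m < n" "p + q + 3 \<le> w"
  shows "(\<Sum>i=1..w - 1. of_int (stuffle_coeff p q i (w - i)) * (1 / m ^ i * (1 / n ^ (w - i)) + 1 / n ^ i * (1 / m ^ (w - i)))) =
    (\<Sum>u=1..w - 2. of_int (shuffle_coeff p q u (w - u)) * ((-1) ^ u * (1 / (n - m) ^ u * (1 / m ^ (w - u))) +
        1 / (n - m) ^ u * (1 / n ^ (w - u))))"
proof -
  let ?L = "\<lambda>p q. \<Sum>i=1..w - 1. real ((i - 1) choose p) * real ((w - i - 1) choose q) * (1 / (m ^ i * n ^ (w - i)))"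
  have "(\<Sum>i=1..w - 1. of_int (stuffle_coeff p q i (w - i)) * (1 / m ^ i * (1 / n ^ (w - i)) + 1 / n ^ i * (1 / m ^ (w - i)))) =
      ?L p q + (\<Sum>i=1..w - 1. real ((i - 1) choose p) * real ((w - i - 1) choose q) * (1 / (n ^ i * m ^ (w - i))))"
    unfolding sum.distrib[symmetric] by (intro sum.cong refl) (simp add: stuffle_coeff_def algebra_simps)
  also have "(\<Sum>i=1..w - 1. real ((i - 1) choose p) * real ((w - i - 1) choose q) * (1 / (n ^ i * m ^ (w - i)))) = ?L q p"
    by (rule sum.reindex_bij_witness[of _ "\<lambda>i. w - i" "\<lambda>i. w - i"]) (use assms in \<open>auto simp: mult_ac\<close>)
  also have "?L p q + ?L q p =
    (\<Sum>u=1..p + q + 1. of_int (shuffle_coeff p q u (w - u)) * ((-1) ^ u * (1 / (n - m) ^ u * (1 / m ^ (w - u))) +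
        1 / (n - m) ^ u * (1 / n ^ (w - u))))"
    using assms partial_fractions_coefficients[of m n p q w] partial_fractions_coefficients[of m n q p w]
    by (simp only: add.commute[of q p])
      (auto simp: shuffle_coeff_def algebra_simps power_add simp flip: sum.distrib sum_negf intro!: sum.cong)
  \<comment> \<open>The bound on w gives p + q + 1 <= w - 2, and \<open>shuffle_coeff\<close>
    vanishes on the added range.\<close>
  also have "\<dots> = (\<Sum>u=1..w - 2. of_int (shuffle_coeff p q u (w - u)) * ((-1) ^ u * (1 / (n - m) ^ u * (1 / m ^ (w - u))) +
        1 / (n - m) ^ u * (1 / n ^ (w - u))))"
    using assms by (intro sum.mono_neutral_left) (auto simp: shuffle_coeff_def)
  finally show ?thesis .
qed

text \<open>Summed over m < n, one side of the symmetrized identity becomes products of zeta values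
  by the stuffle product, the other becomes signed products and double zeta values through the
  differences n - m. The relation is the equality of the two results.\<close>

lemma mzv_double_shuffle:
  assumes "p + q + 4 \<le> w"
  shows "real ((w - 1) choose (p + q + 1)) * mzv [w] +
    (\<Sum>i=2..w - 2. of_int ((-1) ^ i * shuffle_coeff p q i (w - i) - stuffle_coeff p q i (w - i)) * mzv [i] * mzv [w - i]) +
    (\<Sum>i=1..w - 2. of_int (shuffle_coeff p q i (w - i)) * mzv [i, w - i]) = 0"
proof -
  let ?c = "\<lambda>i. real_of_int (stuffle_coeff p q i (w - i))"
  let ?e = "\<lambda>i. real_of_int (shuffle_coeff p q i (w - i))"
  \<comment> \<open>\<open>K\<close> is the total coefficient of the terms with an exponent 1, which converge only when grouped as in
    \<open>has_sum_regularized\<close>.\<close>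
  define K where "K = ?c 1 + ?c (w - 1)"
  have w: "4 \<le> w" using assms by simp
  \<comment> \<open>Both sides vanish unless p = 0 or q = 0, when the binomial coefficient that
    remains is that of w - 2 over p + q. This match allows all terms with an exponent 1 to be
    grouped.\<close>
  have e1: "?e 1 = - K"
  proof -
    have "w - 1 - 1 choose (p + q + 1 - 1) = (w - 2) choose (p + q)" by (simp add: numeral_2_eq_2)
    then show ?thesis using assms
      by (cases p; cases q) (auto simp: K_def stuffle_coeff_def shuffle_coeff_def)
  qed
  have lhs: "((\<lambda>(m, n). \<Sum>i=2..w - 2. ?c i * (1 / real m ^ i * (1 / real n ^ (w - i)) + 1 / real n ^ i * (1 / real m ^ (w - i)))) has_sum
      (\<Sum>i=2..w - 2. ?c i * (mzv [i, w - i] + mzv [w - i, i]))) increasing_pairs"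
  proof -
    have "((\<lambda>z. \<Sum>i=2..w - 2. ?c i * ((\<lambda>(m, n). 1 / real m ^ i * (1 / real n ^ (w - i))) z +
        (\<lambda>(m, n). 1 / real m ^ (w - i) * (1 / real n ^ i)) z)) has_sum
      (\<Sum>i=2..w - 2. ?c i * (mzv [i, w - i] + mzv [w - i, i]))) increasing_pairs"
      using w by (intro has_sum_finite_sum has_sum_cmult_right has_sum_add has_sum_mzv_2) auto
    then show ?thesis by (simp add: case_prod_unfold mult_ac)
  qed
  have rhs: "((\<lambda>(m, n). (\<Sum>i=2..w - 2. ?e i * ((-1) ^ i * (1 / (real n - real m) ^ i * (1 / real m ^ (w - i))) +
        1 / (real n - real m) ^ i * (1 / real n ^ (w - i)))) +
      - K * (1 / (real n - real m) ^ 1 * (1 / real n ^ (w - 1)) + 1 / real m ^ 1 * (1 / real n ^ (w - 1)) +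
        - 1 * ((1 / (real n - real m) - 1 / real n) * (1 / real m ^ (w - 1))))) has_sum
      ((\<Sum>i=2..w - 2. ?e i * ((-1) ^ i * (mzv [i] * mzv [w - i]) + mzv [i, w - i])) +
       - K * (mzv [1, w - 1] + mzv [1, w - 1] + - 1 * (mzv [1, w - 1] + mzv [w])))) increasing_pairs"
  proof -
    have "((\<lambda>z. (\<Sum>i=2..w - 2. ?e i * ((-1) ^ i * (\<lambda>(m, n). 1 / (real n - real m) ^ i * (1 / real m ^ (w - i))) z +
        (\<lambda>(m, n). 1 / (real n - real m) ^ i * (1 / real n ^ (w - i))) z)) +
      - K * ((\<lambda>(m, n). 1 / (real n - real m) ^ 1 * (1 / real n ^ (w - 1))) z +
        (\<lambda>(m, n). 1 / real m ^ 1 * (1 / real n ^ (w - 1))) z +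
        - 1 * (\<lambda>(m, n). (1 / (real n - real m) - 1 / real n) * (1 / real m ^ (w - 1))) z)) has_sum
      ((\<Sum>i=2..w - 2. ?e i * ((-1) ^ i * (mzv [i] * mzv [w - i]) + mzv [i, w - i])) +
       - K * (mzv [1, w - 1] + mzv [1, w - 1] + - 1 * (mzv [1, w - 1] + mzv [Suc (w - 1)])))) increasing_pairs"
      using w by (intro has_sum_add has_sum_finite_sum has_sum_cmult_right has_sum_difference_product
          has_sum_difference_mzv has_sum_mzv_2 has_sum_regularized) auto
    then show ?thesis using w by (simp add: case_prod_unfold)
  qed
  have split1: "(\<Sum>i=1..w - 1. f i) = f 1 + f (w - 1) + (\<Sum>i=2..w - 2. f i)" for f :: "nat \<Rightarrow> real"
  proof -
    have "{1..w - 1} = insert 1 (insert (w - 1) {2..w - 2})" using w by auto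
    moreover have "w - 1 \<notin> {2..w - 2}" "1 \<notin> insert (w - 1) {2..w - 2}" using w by auto
    ultimately show ?thesis by (simp only: sum.insert finite_insert finite_atLeastAtMost add.assoc not_False_eq_True)
  qed
  have split2: "(\<Sum>i=1..w - 2. f i) = f 1 + (\<Sum>i=2..w - 2. f i)" for f :: "nat \<Rightarrow> real"
  proof -
    have "{1..w - 2} = insert 1 {2..w - 2}" using w by auto
    then show ?thesis by simp
  qed
  have "(\<Sum>i=2..w - 2. ?c i * (1 / m ^ i * (1 / n ^ (w - i)) + 1 / n ^ i * (1 / m ^ (w - i)))) =
      (\<Sum>i=2..w - 2. ?e i * ((-1) ^ i * (1 / (n - m) ^ i * (1 / m ^ (w - i))) + 1 / (n - m) ^ i * (1 / n ^ (w - i)))) +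
      - K * (1 / (n - m) ^ 1 * (1 / n ^ (w - 1)) + 1 / m ^ 1 * (1 / n ^ (w - 1)) +
        - 1 * ((1 / (n - m) - 1 / n) * (1 / m ^ (w - 1))))"
    if "0 < m" "m < n" for m n :: real
  proof -
    have "w - (w - 1) = 1" using w by simp
    then show ?thesis
      using symmetrized_partial_fractions[OF that, of p q w] assms
      unfolding split1 split2 e1 by (simp add: K_def algebra_simps)
  qed
  then have "(\<Sum>i=2..w - 2. ?c i * (mzv [i, w - i] + mzv [w - i, i])) =
      (\<Sum>i=2..w - 2. ?e i * ((-1) ^ i * (mzv [i] * mzv [w - i]) + mzv [i, w - i])) +
       - K * (mzv [1, w - 1] + mzv [1, w - 1] + - 1 * (mzv [1, w - 1] + mzv [w]))"
    by (intro has_sum_unique[OF lhs] has_sum_cong[THEN iffD2, OF _ rhs]) auto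
  moreover have "(\<Sum>i=2..w - 2. ?c i * (mzv [i, w - i] + mzv [w - i, i])) =
      (\<Sum>i=2..w - 2. ?c i * (mzv [i] * mzv [w - i])) - (\<Sum>i=2..w - 2. ?c i) * mzv [w]"
    unfolding sum_distrib_right sum_subtractf[symmetric]
  proof (intro sum.cong refl)
    fix i assume "i \<in> {2..w - 2}"
    then have "2 \<le> i" "2 \<le> w - i" "i + (w - i) = w" using w by auto
    then have "mzv [i] * mzv [w - i] = mzv [i, w - i] + mzv [w - i, i] + mzv [w]"
      using mzv_stuffle[of i "w - i"] by simp
    then show "?c i * (mzv [i, w - i] + mzv [w - i, i]) = ?c i * (mzv [i] * mzv [w - i]) - ?c i * mzv [w]"
      by (simp add: algebra_simps)
  qed
  \<comment> \<open>The K removed here cancels the K \<zeta>(w) coming from the regularized sum, so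
    \<zeta>(w) keeps a plain binomial coefficient.\<close>
  moreover have "(\<Sum>i=2..w - 2. ?c i) = real ((w - 1) choose (p + q + 1)) - K"
  proof -
    have "(\<Sum>i=1..w - 1. ?c i) = real (\<Sum>i=1..w - 1. ((i - 1) choose p) * ((w - i - 1) choose q))"
      by (simp add: stuffle_coeff_def)
    also have "\<dots> = real ((w - 1) choose (p + q + 1))"
      using assms by (subst sum_choose_mult_choose) auto
    finally show ?thesis unfolding split1 by (simp add: K_def)
  qed
  ultimately show ?thesis
    unfolding split2 e1 by (simp add: algebra_simps sum.distrib sum_subtractf)
qed

section \<open>The coefficients of the formula\<close>

lemma ibinom_of_nat: "ibinom (int n) (int k) = int (n choose k)"
  by (simp add: ibinom_def int_binomial gbinomial_prod_rev atLeast0LessThan)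

lemma ibinom_neg: "k < 0 \<Longrightarrow> ibinom n k = 0"
  by (simp add: ibinom_def)

lemma ibinom_eq:
  "0 \<le> n \<Longrightarrow> ibinom n k = (if k < 0 then 0 else int (nat n choose nat k))"
  using ibinom_of_nat[of "nat n" "nat k"] by (cases "k < 0") (simp_all add: ibinom_neg)

lemma ibinom_Pascal:
  assumes "0 \<le> n"
  shows "ibinom n k + ibinom n (k - 1) = ibinom (n + 1) k"
proof (cases "0 < k")
  case True
  then obtain j where "k = 1 + int j" by (metis zless_iff_Suc_zadd add.commute of_nat_Suc add_0)
  then show ?thesis using assms by (simp add: ibinom_eq nat_add_distrib)
qed (use assms in \<open>auto simp: ibinom_eq\<close>)

text \<open>The alternating sign cancels all common terms of the two inner sums, leaving only j = s2
  + 1. The other two products are combined by Pascal's rule for w2 - 2.\<close>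

lemma coeff_C_step:
  assumes "1 \<le> w1" "2 \<le> w2"
  shows "coeff_C w1 w2 s1 (Suc s2) + coeff_C w1 w2 s1 s2 = shuffle_coeff s1 s2 w1 w2"
proof -
  let ?A = "\<lambda>s2. {(i, j). 0 \<le> i \<and> i \<le> s1 \<and> 1 \<le> j \<and> j \<le> s2 \<and> i + j = w1}"
  let ?f = "\<lambda>(i, j :: nat). ibinom (int w1 - 1) (int i) * ibinom (int w2 - 1) (int s1 - int i)"
  let ?x = "of_bool (w1 \<le> s1 + s2 + 1) * int ((w1 - 1) choose s2) * int ((w2 - 1) choose (s1 + s2 + 1 - w1))"
  have fin: "finite (?A s)" for s
    by (rule finite_subset[of _ "{..s1} \<times> {..s}"]) auto
  have "sum ?f (?A (Suc s2)) = sum ?f (?A s2) + ?x"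
  proof (cases "Suc s2 \<le> w1 \<and> w1 \<le> s1 + s2 + 1")
    case True
    then have "?A (Suc s2) = insert (w1 - Suc s2, Suc s2) (?A s2)" by auto
    moreover have "?f (w1 - Suc s2, Suc s2) = ?x"
    proof -
      have "int w1 - 1 = int (w1 - 1)" "int w2 - 1 = int (w2 - 1)"
        "int s1 - int (w1 - Suc s2) = int (s1 + s2 + 1 - w1)" using assms True by auto
      moreover have "s2 \<le> w1 - 1" "w1 - 1 - s2 = w1 - Suc s2" using True by auto
      then have "(w1 - 1) choose (w1 - Suc s2) = (w1 - 1) choose s2"
        by (metis binomial_symmetric)
      ultimately show ?thesis using True by (simp only: prod.case ibinom_of_nat) simp
    qed
    ultimately show ?thesis using fin[of s2] by (simp only:) (subst sum.insert, auto)
  next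
    case False
    then have "?A (Suc s2) = ?A s2" by auto
    moreover have "?x = 0" using False assms by (auto simp: not_le)
    ultimately show ?thesis by simp
  qed
  then have 1: "(-1) ^ Suc s2 * sum ?f (?A (Suc s2)) + (-1) ^ s2 * sum ?f (?A s2) = - ((-1) ^ s2 * ?x)"
    by (simp add: algebra_simps)
  let ?b = "ibinom (int w2 - 2)"
  have "?b (int s1 + int (Suc s2) - int w1) + ?b (int s1 + int s2 - int w1) =
      ibinom (int w2 - 2 + 1) (int s1 + int (Suc s2) - int w1)"
    using assms by (subst ibinom_Pascal[symmetric]) (auto simp: algebra_simps)
  also have "\<dots> = of_bool (w1 \<le> s1 + s2 + 1) * int ((w2 - 1) choose (s1 + s2 + 1 - w1))"
    using assms by (subst ibinom_eq) (auto simp: nat_diff_distrib nat_add_distrib of_bool_def intro!: arg_cong2[where f = "(choose)"])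
  finally have 2: "?b (int s1 + int (Suc s2) - int w1) + ?b (int s1 + int s2 - int w1) =
    of_bool (w1 \<le> s1 + s2 + 1) * int ((w2 - 1) choose (s1 + s2 + 1 - w1))" .
  have X: "ibinom (int w1 - 1) (int s1) = int ((w1 - 1) choose s1)"
    using assms by (simp add: ibinom_eq nat_diff_distrib)
  have "coeff_C w1 w2 s1 (Suc s2) + coeff_C w1 w2 s1 s2 =
     ((-1) ^ Suc s2 * sum ?f (?A (Suc s2)) + (-1) ^ s2 * sum ?f (?A s2)) -
     (-1) ^ s1 * ibinom (int w1 - 1) (int s1) * (?b (int s1 + int (Suc s2) - int w1) + ?b (int s1 + int s2 - int w1))"
    unfolding coeff_C_def by (simp only: algebra_simps)
  also have "\<dots> = shuffle_coeff s1 s2 w1 w2"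
    unfolding 1 2 X by (simp add: shuffle_coeff_def algebra_simps)
  finally show ?thesis .
qed

text \<open>The restricted sum in B depends on s2 and r1 only through s2 + r1. It is the same in
  both terms, with opposite signs, so only C contributes.\<close>

lemma coeff_B_step:
  assumes "1 \<le> w1" "2 \<le> w2"
  shows "coeff_B w1 w2 s1 (Suc s2) r1 r2 + coeff_B w1 w2 s1 s2 (Suc r1) r2 = shuffle_coeff s1 s2 w1 w2"
proof -
  have "int (Suc s2) + int r1 = int s2 + int (Suc r1)" by simp
  then show ?thesis
    unfolding coeff_B_def coeff_C_step[OF assms, symmetric] by (simp only:) (simp add: algebra_simps)
qed

text \<open>The indicator on the right describes the weights for which both factors of the free-pair
  sum are nonzero. Besides C, all terms of A share the factor \<open>X\<close>; what is left is
  Pascal's rule in s2 together with a comparison of the thresholds.\<close>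

lemma coeff_A_step:
  assumes "2 \<le> w1" "2 \<le> w2" "0 < r1" "0 < r2" "s1 + s2 + r1 + r2 + 3 \<le> w1 + w2"
  shows "coeff_A w1 w2 s1 (Suc s2) r1 r2 + coeff_A w1 w2 s1 s2 (Suc r1) r2 =
    (-1) ^ w1 * shuffle_coeff s1 s2 w1 w2 -
    stuffle_coeff s1 s2 w1 w2 * (1 - of_bool (s1 + Suc r1 + 1 \<le> w1 \<and> s2 + r2 + 1 \<le> w2))"
proof -
  let ?b = "ibinom (int w2 - 2)"
  define X where "X = ibinom (int w1 - 1) (int s1)"
  have sgn: "(-1 :: int) ^ (2 * n + k) = (-1) ^ k" for n k by (simp add: power_add power_mult)
  let ?br = "\<lambda>s2 r1. - of_bool (w1 \<le> s1 + r1 \<or> int w2 \<le> int s2 + int r2 - 1) * ?b (int s2 - 1)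
    + of_bool (w1 > s1 + r1) * (-1) ^ (s1 + r1 + w1) * ?b (int s1 + int s2 + int r1 - int w1)
    + of_bool (r2 < w2 \<and> int w2 \<le> int s2 + int r2 - 1) * (-1) ^ (s2 + r2 + w2) * ?b (int r2 - 1)"
  have A: "coeff_A w1 w2 s1 s2 r1 r2 = (-1) ^ w1 * coeff_C w1 w2 s1 s2 + X * ?br s2 r1" for s2 r1
    unfolding coeff_A_def X_def by (simp add: algebra_simps)
  have "?b (int s2) + ?b (int s2 - 1) = ibinom (int w2 - 2 + 1) (int s2)"
    using assms by (intro ibinom_Pascal) auto
  also have "\<dots> = int ((w2 - 1) choose s2)"
    using assms by (simp add: ibinom_eq nat_diff_distrib)
  finally have pascal: "?b (int s2) + ?b (int s2 - 1) = int ((w2 - 1) choose s2)" .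
  have "?br (Suc s2) r1 + ?br s2 (Suc r1) =
    - (?b (int s2) + ?b (int s2 - 1)) * (1 - of_bool (s1 + Suc r1 + 1 \<le> w1 \<and> s2 + r2 + 1 \<le> w2))"
  proof -
    \<comment> \<open>The indicators of the two terms switch at neighbouring thresholds, so w1 = s1
      + r1 + 1 and w2 = s2 + r2 are critical. Away from these values the signed terms vanish or
      cancel in pairs.\<close>
    consider "w1 \<le> s1 + r1" | "w1 = s1 + r1 + 1" | "s1 + r1 + 1 < w1" "s2 + r2 + 1 \<le> w2"
      | "s1 + r1 + 1 < w1" "w2 = s2 + r2" | "s1 + r1 + 1 < w1" "w2 < s2 + r2" by linarith
    then show ?thesis
    proof cases
      case 2
      have "(-1 :: int) ^ (s1 + r1 + w1) = -1"
        using sgn[of "s1 + r1" 1] by (simp add: 2 mult_2)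
      then show ?thesis using assms 2 by simp
    next
      case 4
      have sg: "(-1 :: int) ^ (s2 + r2 + w2) = 1"
        using sgn[of "s2 + r2" 0] by (simp add: 4 mult_2)
      show ?thesis
      proof (cases s2)
        case 0
        then show ?thesis using assms 4 by (simp add: ibinom_neg)
      next
        case (Suc k)
        \<comment> \<open>For w2 = s2 + r2 the two lower indices add up to w2 - 2. This is the place
          where the last term of A supplies a summand missing from the first.\<close>
        have "?b (int r2 - 1) = ?b (int s2 - 1)"
          using binomial_symmetric[of k "w2 - 2"] assms 4
          by (simp add: Suc ibinom_eq nat_diff_distrib nat_add_distrib)
        then show ?thesis using assms 4 sg by (simp add: Suc algebra_simps)
      qed
    qed (use assms in \<open>auto simp: algebra_simps\<close>)
  qed
  then have br: "?br (Suc s2) r1 + ?br s2 (Suc r1) =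
      - int ((w2 - 1) choose s2) * (1 - of_bool (s1 + Suc r1 + 1 \<le> w1 \<and> s2 + r2 + 1 \<le> w2))"
    unfolding pascal .
  have "X = int ((w1 - 1) choose s1)"
    using assms by (simp add: X_def ibinom_eq nat_diff_distrib)
  then have st: "stuffle_coeff s1 s2 w1 w2 = X * int ((w2 - 1) choose s2)"
    by (simp add: stuffle_coeff_def)
  have "coeff_A w1 w2 s1 (Suc s2) r1 r2 + coeff_A w1 w2 s1 s2 (Suc r1) r2 =
      (-1) ^ w1 * (coeff_C w1 w2 s1 (Suc s2) + coeff_C w1 w2 s1 s2) + X * (?br (Suc s2) r1 + ?br s2 (Suc r1))"
    unfolding A by (simp only: distrib_left add_ac)
  also have "coeff_C w1 w2 s1 (Suc s2) + coeff_C w1 w2 s1 s2 = shuffle_coeff s1 s2 w1 w2"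
    using assms by (intro coeff_C_step) auto
  finally show ?thesis unfolding br st by (simp add: algebra_simps)
qed

lemma coeff_C_zero:
  assumes "1 \<le> w1"
  shows "coeff_C w1 w2 s 0 = 0"
proof -
  have empty: "{(i, j). 0 \<le> i \<and> i \<le> s \<and> 1 \<le> j \<and> j \<le> 0 \<and> i + j = w1} = {}" by auto
  show ?thesis
  \<comment> \<open>The first sum is empty. In the second term either w1 - 1 < s kills the first
    binomial coefficient, or the lower index s - w1 of the second is negative.\<close>
  proof (cases "w1 \<le> s")
    case True
    then have "ibinom (int w1 - 1) (int s) = 0" using assms by (simp add: ibinom_eq nat_diff_distrib)
    then show ?thesis unfolding coeff_C_def empty by simp
  next
    case False
    then show ?thesis unfolding coeff_C_def empty by (simp add: ibinom_neg)
  qed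
qed

lemma coeff_A_zero:
  assumes "2 \<le> w1" "2 \<le> w2" "0 < r1"
  shows "coeff_A w1 w2 s 0 r1 r2 = 0"
proof -
  have C: "coeff_C w1 w2 s 0 = 0"
    using assms by (intro coeff_C_zero) auto
  have "of_bool (w1 > s + r1) * ibinom (int w2 - 2) (int s + int 0 + int r1 - int w1) = 0"
    by (simp add: ibinom_neg)
  then show ?thesis by (auto simp: coeff_A_def C ibinom_neg)
qed

text \<open>By Vandermonde the added binomial coefficient is the sum over all t1 + t2 = s. The
  coefficient B removes those violating one of the bounds, so exactly the pairs occurring in
  \<open>S_zero\<close> remain.\<close>

lemma coeff_B_zero:
  assumes "1 \<le> w1" "2 \<le> w2"
  shows "coeff_B w1 w2 s 0 r1 r2 + int ((w1 + w2 - 2) choose s) =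
    (\<Sum>(t1, t2)\<in>{(t1, t2). t1 + t2 = s \<and> t1 + r1 < w1 \<and> t2 + r2 < w2}.
      int ((w1 - 1) choose t1) * int ((w2 - 1) choose t2))"
proof -
  have C: "coeff_C w1 w2 s 0 = 0"
    using assms by (intro coeff_C_zero) auto
  let ?f = "\<lambda>(t1, t2). int ((w1 - 1) choose t1) * int ((w2 - 1) choose t2)"
  let ?T = "{(t1, t2). t1 + t2 = s}"
  let ?U = "{(t1, t2). t1 + t2 = s \<and> (int t1 \<ge> int w1 - (int 0 + int r1) \<or> int t2 \<ge> int w2 - int r2)}"
  let ?V = "{(t1, t2). t1 + t2 = s \<and> t1 + r1 < w1 \<and> t2 + r2 < w2}"
  have fin: "finite ?T"
    by (rule finite_subset[of _ "{..s} \<times> {..s}"]) auto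
  have "ibinom (int w1 - 1) (int t) = int ((w1 - 1) choose t)" "ibinom (int w2 - 1) (int t) = int ((w2 - 1) choose t)" for t
    using assms by (simp_all add: ibinom_eq nat_diff_distrib)
  then have "coeff_B w1 w2 s 0 r1 r2 = - sum ?f ?U"
    by (simp add: coeff_B_def C)
  moreover have "sum ?f ?T = sum ?f ?U + sum ?f ?V"
  proof -
    have "?T = ?U \<union> ?V" by auto
    moreover have "?U \<inter> ?V = {}" by auto
    ultimately show ?thesis using fin by (metis (no_types, lifting) finite_Un sum.union_disjoint)
  qed
  moreover have "sum ?f ?T = int ((w1 + w2 - 2) choose s)"
  proof -
    have "sum ?f ?T = (\<Sum>k\<le>s. int ((w1 - 1) choose k) * int ((w2 - 1) choose (s - k)))"
      by (rule sum.reindex_bij_witness[of _ "\<lambda>k. (k, s - k)" fst]) auto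
    also have "\<dots> = int ((w1 - 1 + (w2 - 1)) choose s)"
      by (simp add: vandermonde[symmetric])
    also have "w1 - 1 + (w2 - 1) = w1 + w2 - 2" using assms by simp
    finally show ?thesis .
  qed
  ultimately show ?thesis by simp
qed

section \<open>The closed formula satisfies the same recursion\<close>

definition zeta_form :: "nat \<Rightarrow> nat \<Rightarrow> nat \<Rightarrow> nat \<Rightarrow> nat \<Rightarrow> real"
  where "zeta_form w s1 s2 r1 r2 =
    of_int (ibinom (int w - 2) (int s1 + int s2)) * mzv [w]
    + (\<Sum>(w1, w2)\<in>{(w1, w2). w1 \<ge> 2 \<and> w2 \<ge> 2 \<and> w1 + w2 = w}.
         of_int (coeff_A w1 w2 s1 s2 r1 r2) * mzv [w1] * mzv [w2])
    + (\<Sum>(w1, w2)\<in>{(w1, w2). w1 \<ge> 1 \<and> w2 \<ge> 2 \<and> w1 + w2 = w}.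
         of_int (coeff_B w1 w2 s1 s2 r1 r2) * mzv [w1, w2])"

lemma sum_pairs_from_1:
  fixes f :: "nat \<Rightarrow> nat \<Rightarrow> 'a :: comm_monoid_add"
  shows "(\<Sum>(w1, w2)\<in>{(w1, w2). w1 \<ge> 1 \<and> w2 \<ge> 2 \<and> w1 + w2 = w}. f w1 w2) = (\<Sum>i=1..w - 2. f i (w - i))"
  by (rule sum.reindex_bij_witness[of _ "\<lambda>i. (i, w - i)" fst]) auto

lemma sum_pairs_from_2:
  fixes f :: "nat \<Rightarrow> nat \<Rightarrow> 'a :: comm_monoid_add"
  shows "(\<Sum>(w1, w2)\<in>{(w1, w2). w1 \<ge> 2 \<and> w2 \<ge> 2 \<and> w1 + w2 = w}. f w1 w2) = (\<Sum>i=2..w - 2. f i (w - i))"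
  by (rule sum.reindex_bij_witness[of _ "\<lambda>i. (i, w - i)" fst]) auto

text \<open>Pascal's rule and the step lemmas for A and B split the sum into the left-hand side of
  \<open>mzv_double_shuffle\<close>, which is zero, and the stuffle terms selected by the indicator,
  which are the products of block sums.\<close>

lemma zeta_form_recursion:
  assumes "0 < r1" "0 < r2" "s1 + Suc s2 + r1 + r2 + 2 \<le> w"
  shows "zeta_form w s1 (Suc s2) r1 r2 + zeta_form w s1 s2 (Suc r1) r2 =
    (\<Sum>w1\<le>w. block_zeta s1 (Suc r1) w1 * block_zeta s2 r2 (w - w1))"
proof -
  let ?c = "\<lambda>i. of_bool (s1 + Suc r1 + 1 \<le> i \<and> s2 + r2 + 1 \<le> w - i)"
  let ?st = "\<lambda>i. real_of_int (stuffle_coeff s1 s2 i (w - i))"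
  have z: "real_of_int (ibinom (int w - 2) (int s1 + int (Suc s2))) + real_of_int (ibinom (int w - 2) (int s1 + int s2)) =
      real ((w - 1) choose (s1 + s2 + 1))"
  proof -
    have "ibinom (int w - 2) (int s1 + int (Suc s2)) + ibinom (int w - 2) (int s1 + int s2) =
        ibinom (int w - 2 + 1) (int s1 + int (Suc s2))"
      using assms by (subst ibinom_Pascal[symmetric]) (auto simp: algebra_simps)
    also have "\<dots> = ibinom (int (w - 1)) (int (s1 + s2 + 1))"
      using assms by (intro arg_cong2[where f = ibinom]) auto
    finally show ?thesis unfolding ibinom_of_nat by (metis of_int_add of_int_of_nat_eq)
  qed
  have "zeta_form w s1 (Suc s2) r1 r2 + zeta_form w s1 s2 (Suc r1) r2 =
     (real_of_int (ibinom (int w - 2) (int s1 + int (Suc s2))) + real_of_int (ibinom (int w - 2) (int s1 + int s2))) * mzv [w] +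
     (\<Sum>i=2..w - 2. of_int (coeff_A i (w - i) s1 (Suc s2) r1 r2 + coeff_A i (w - i) s1 s2 (Suc r1) r2) * mzv [i] * mzv [w - i]) +
     (\<Sum>i=1..w - 2. of_int (coeff_B i (w - i) s1 (Suc s2) r1 r2 + coeff_B i (w - i) s1 s2 (Suc r1) r2) * mzv [i, w - i])"
    unfolding zeta_form_def sum_pairs_from_1 sum_pairs_from_2
    by (simp add: algebra_simps sum.distrib)
  also have "(\<Sum>i=2..w - 2. of_int (coeff_A i (w - i) s1 (Suc s2) r1 r2 + coeff_A i (w - i) s1 s2 (Suc r1) r2) * mzv [i] * mzv [w - i]) =
    (\<Sum>i=2..w - 2. of_int ((-1) ^ i * shuffle_coeff s1 s2 i (w - i) - stuffle_coeff s1 s2 i (w - i)) * mzv [i] * mzv [w - i]) +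
    (\<Sum>i=2..w - 2. ?st i * ?c i * mzv [i] * mzv [w - i])"
    unfolding sum.distrib[symmetric]
  proof (intro sum.cong refl)
    fix i assume "i \<in> {2..w - 2}"
    then have "2 \<le> i" "2 \<le> w - i" "i + (w - i) = w" using assms by auto
    then have "coeff_A i (w - i) s1 (Suc s2) r1 r2 + coeff_A i (w - i) s1 s2 (Suc r1) r2 =
      ((-1) ^ i * shuffle_coeff s1 s2 i (w - i) - stuffle_coeff s1 s2 i (w - i)) + stuffle_coeff s1 s2 i (w - i) * ?c i"
      using assms coeff_A_step[of i "w - i" r1 r2 s1 s2] by (simp add: algebra_simps)
    then show "of_int (coeff_A i (w - i) s1 (Suc s2) r1 r2 + coeff_A i (w - i) s1 s2 (Suc r1) r2) * mzv [i] * mzv [w - i] =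
      of_int ((-1) ^ i * shuffle_coeff s1 s2 i (w - i) - stuffle_coeff s1 s2 i (w - i)) * mzv [i] * mzv [w - i] +
      ?st i * ?c i * mzv [i] * mzv [w - i]"
      by (simp only: of_int_add of_int_mult of_int_of_bool distrib_right)
  qed
  also have "(\<Sum>i=1..w - 2. of_int (coeff_B i (w - i) s1 (Suc s2) r1 r2 + coeff_B i (w - i) s1 s2 (Suc r1) r2) * mzv [i, w - i]) =
    (\<Sum>i=1..w - 2. of_int (shuffle_coeff s1 s2 i (w - i)) * mzv [i, w - i])"
    using assms by (intro sum.cong refl arg_cong2[where f = "(*)"] arg_cong[where f = real_of_int] coeff_B_step) auto
  \<comment> \<open>\<open>block_zeta\<close> vanishes outside the range selected by the indicator,
    and its binomial factors multiply to \<open>stuffle_coeff\<close>.\<close>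
  also have "(\<Sum>i=2..w - 2. ?st i * ?c i * mzv [i] * mzv [w - i]) =
      (\<Sum>w1\<le>w. block_zeta s1 (Suc r1) w1 * block_zeta s2 r2 (w - w1))"
    using assms by (intro sum.mono_neutral_cong_left) (auto simp: block_zeta_def stuffle_coeff_def)
  finally show ?thesis
    using mzv_double_shuffle[of s1 s2 w] assms unfolding z by simp
qed

text \<open>All A vanish. Expanding \<zeta>(w) by the depth two sum formula adds the binomial
  coefficient of w - 2 over s to each B, and \<open>coeff_B_zero\<close> identifies the result with
  \<open>S_zero\<close>.\<close>

lemma zeta_form_zero:
  assumes "0 < r1" "0 < r2" "s + r1 + r2 + 2 \<le> w"
  shows "zeta_form w s 0 r1 r2 = S w s 0 r1 r2"
proof -
  let ?W = "{(w1, w2). w1 \<ge> 1 \<and> w2 \<ge> 2 \<and> w1 + w2 = w}"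
  let ?T = "\<lambda>w1 w2. {(t1, t2). t1 + t2 = s \<and> t1 + r1 < w1 \<and> t2 + r2 < w2}"
  have finW: "finite ?W" by (rule finite_subset[of _ "{..w} \<times> {..w}"]) auto
  have finT: "finite (?T w1 w2)" for w1 w2 by (rule finite_subset[of _ "{..s} \<times> {..s}"]) auto
  have "(\<Sum>(w1, w2)\<in>{(w1, w2). w1 \<ge> 2 \<and> w2 \<ge> 2 \<and> w1 + w2 = w}. of_int (coeff_A w1 w2 s 0 r1 r2) * mzv [w1] * mzv [w2]) = 0"
    using assms by (intro sum.neutral) (auto simp: coeff_A_zero)
  moreover have "ibinom (int w - 2) (int s + int 0) = int ((w - 2) choose s)"
    using assms by (simp add: ibinom_eq nat_diff_distrib)
  moreover have "(\<Sum>(w1, w2)\<in>?W. mzv [w1, w2]) = mzv [w]"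
    using assms by (intro sum_mzv_2) auto
  ultimately have "zeta_form w s 0 r1 r2 = real ((w - 2) choose s) * (\<Sum>(w1, w2)\<in>?W. mzv [w1, w2]) +
      (\<Sum>(w1, w2)\<in>?W. of_int (coeff_B w1 w2 s 0 r1 r2) * mzv [w1, w2])"
    by (simp only: zeta_form_def)
  also have "\<dots> = (\<Sum>(w1, w2)\<in>?W. of_int (coeff_B w1 w2 s 0 r1 r2 + int ((w1 + w2 - 2) choose s)) * mzv [w1, w2])"
    unfolding sum_distrib_left sum.distrib[symmetric] by (intro sum.cong refl) (auto simp: algebra_simps)
  also have "\<dots> = (\<Sum>(w1, w2)\<in>?W. \<Sum>(t1, t2)\<in>?T w1 w2. real ((w1 - 1) choose t1) * real ((w2 - 1) choose t2) * mzv [w1, w2])"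
  proof (intro sum.cong refl)
    fix q assume "q \<in> ?W"
    then obtain w1 w2 where q: "q = (w1, w2)" "1 \<le> w1" "2 \<le> w2" by auto
    show "(case q of (w1, w2) \<Rightarrow> of_int (coeff_B w1 w2 s 0 r1 r2 + int ((w1 + w2 - 2) choose s)) * mzv [w1, w2]) =
      (case q of (w1, w2) \<Rightarrow> \<Sum>(t1, t2)\<in>?T w1 w2. real ((w1 - 1) choose t1) * real ((w2 - 1) choose t2) * mzv [w1, w2])"
      unfolding q prod.case coeff_B_zero[OF q(2,3)] by (simp add: sum_distrib_right case_prod_unfold)
  qed
  also have "\<dots> = (\<Sum>((w1, w2), (t1, t2))\<in>(SIGMA q:?W. ?T (fst q) (snd q)).
      real ((w1 - 1) choose t1) * real ((w2 - 1) choose t2) * mzv [w1, w2])"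
    using finW finT by (subst sum.Sigma[symmetric]) (auto simp: case_prod_unfold)
  also have "\<dots> = S w s 0 r1 r2"
    unfolding S_zero[OF assms]
    by (rule sum.reindex_bij_witness[of _ "\<lambda>(w1, w2, t1, t2). ((w1, w2), (t1, t2))" "\<lambda>((w1, w2), (t1, t2)). (w1, w2, t1, t2)"])
      (use assms in auto)
  finally show ?thesis .
qed

text \<open>The induction hypothesis is needed for \<open>Suc r1\<close>, hence r1 is arbitrary; the
  bound on w is the same for both terms of the recursion.\<close>

lemma S_eq_zeta_form:
  assumes "0 < r1" "0 < r2" "s1 + s2 + r1 + r2 + 2 \<le> w"
  shows "S w s1 s2 r1 r2 = zeta_form w s1 s2 r1 r2"
  using assms
proof (induction s2 arbitrary: r1)
  case 0
  then show ?case by (simp add: zeta_form_zero)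
next
  case (Suc s2)
  then have "S w s1 s2 (Suc r1) r2 = zeta_form w s1 s2 (Suc r1) r2" by simp
  moreover have "S w s1 (Suc s2) r1 r2 + S w s1 s2 (Suc r1) r2 =
      zeta_form w s1 (Suc s2) r1 r2 + zeta_form w s1 s2 (Suc r1) r2"
    using Suc.prems by (simp add: S_recursion zeta_form_recursion)
  ultimately show ?case by simp
qed

theorem theorem3p13:
  fixes s1 s2 r1 r2 w :: nat
  assumes "r1 > 0" and "r2 > 0" and "w \<ge> s1 + s2 + r1 + r2 + 2"
  shows "S w s1 s2 r1 r2 =
    of_int (ibinom (int w - 2) (int s1 + int s2)) * mzv [w]
    + (\<Sum>(w1, w2)\<in>{(w1, w2). w1 \<ge> 2 \<and> w2 \<ge> 2 \<and> w1 + w2 = w}.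
         of_int (coeff_A w1 w2 s1 s2 r1 r2) * mzv [w1] * mzv [w2])
    + (\<Sum>(w1, w2)\<in>{(w1, w2). w1 \<ge> 1 \<and> w2 \<ge> 2 \<and> w1 + w2 = w}.
         of_int (coeff_B w1 w2 s1 s2 r1 r2) * mzv [w1, w2])"
  using S_eq_zeta_form[OF assms] by (simp only: zeta_form_def)

end
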